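(* Let $\ell\in\{1,3\}$, $g\in E_\ell\cap W(\mathbb{R})$, and let $s>0$ with $s^2\in\{3,4\}$. Then for every $\lambda>0$, $$Z_{s\lambda}g\left(\frac{p}{s^2},0\right)=(-1)^{(\ell-1)/2}\,Z_{s/\lambda}g\left(\frac{p}{s^2},0\right)\quad\text{for all } p=0,1,\dots,s^2-1.$$
   Context: The Fourier transform is $\hat f(\gamma)=\int_{\mathbb{R}}f(x)e^{-2\pi i\gamma x}\,dx$ for $f \in L^1(\mathbb{R})$, extended to $L^2(\mathbb{R})$. For $\ell=0,1,2,3$, $E_\ell\subset L^2(\mathbb{R})$ is the eigenspace of the Fourier transform with eigenvalue $(-i)^\ell$, i.e. the closed span of the Hermite functions $h_{4m+\ell}$, $m\in\mathbb{Z}_{\ge0}$, where $h_n(x)=(-1)^nc_n^{-1/2}e^{\pi x^2}\frac{d^n}{dx^n}e^{-2\pi x^2}$ with $c_n=(2\pi)^n2^{n-1/2}n!$. The Wiener space $W(\mathbb{R})$ consists of all $g\in L^\infty(\mathbb{R})$ with $\sum_{k\in\mathbb{Z}}\operatorname{ess\,sup}_{x\in[0,1]}|g(x+k)|<\infty$. An element $g$ of $E_\ell\cap W(\mathbb{R})$ satisfies $g,\hat g\in W(\mathbb{R})\subset L^1(\mathbb{R})$ and is identified with its continuous representative. For $\lambda>0$ the Zak transform is $Z_\lambda f(x,\gamma)=\sqrt{\lambda}\sum_{k\in\mathbb{Z}}f(\lambda(x+k))e^{-2\pi ik\gamma}$, $x,\gamma\in\mathbb{R}$. *)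

theory Defs
  imports "HOL-Probability.Probability" "HOL-Probability.Essential_Supremum"
begin

text \<open>
  Elements of the Lebesgue spaces are represented by Borel functions from the reals to the complex
  numbers; every almost-everywhere class of Lebesgue measurable functions has such a
  representative, and all the sets of functions below are closed under changing a Borel
  function to an almost everywhere equal one.
\<close>

definition L2 :: "(real \<Rightarrow> complex) set" where
  "L2 = {f \<in> borel_measurable lborel. integrable lborel (\<lambda>x. (norm (f x))\<^sup>2)}"

definition L2norm :: "(real \<Rightarrow> complex) \<Rightarrow> real" where
  "L2norm f = sqrt (LINT x|lborel. (norm (f x))\<^sup>2)"

definition fourier :: "(real \<Rightarrow> complex) \<Rightarrow> real \<Rightarrow> complex" where
  "fourier f \<gamma> = (LINT x|lborel. f x * exp (- 2 * pi * \<i> * \<gamma> * x))"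

text \<open>
  The continuous extension of the Fourier transform from the dense subspace of integrable functions
  of L2 to all of L2, as a relation since values are determined only almost everywhere:
  F represents the transform of f. By Plancherel's theorem the condition
  \<open>fourier (u n) \<in> L2\<close> is automatic; it is stated because \<open>L2norm\<close> is meaningful only on L2.
\<close>

definition is_L2_fourier :: "(real \<Rightarrow> complex) \<Rightarrow> (real \<Rightarrow> complex) \<Rightarrow> bool" where
  "is_L2_fourier f F \<longleftrightarrow> f \<in> L2 \<and> F \<in> L2 \<and>
     (\<exists>u :: nat \<Rightarrow> real \<Rightarrow> complex.
        (\<forall>n. integrable lborel (u n) \<and> u n \<in> L2 \<and> fourier (u n) \<in> L2) \<and>
        (\<lambda>n. L2norm (\<lambda>x. u n x - f x)) \<longlonglongrightarrow> 0 \<and>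
        (\<lambda>n. L2norm (\<lambda>\<gamma>. fourier (u n) \<gamma> - F \<gamma>)) \<longlonglongrightarrow> 0)"

definition fourier_eigenspace :: "nat \<Rightarrow> (real \<Rightarrow> complex) set" where
  "fourier_eigenspace l = {f \<in> L2. is_L2_fourier f (\<lambda>x. (- \<i>) ^ l * f x)}"

definition wiener_space :: "(real \<Rightarrow> complex) set" where
  "wiener_space = {g \<in> borel_measurable lborel.
     esssup lborel (\<lambda>x. ennreal (norm (g x))) < \<infinity> \<and>
     (\<Sum>\<^sub>\<infinity>k::int. esssup (restrict_space lborel {0..1}) (\<lambda>x. ennreal (norm (g (x + of_int k))))) < \<infinity>}"

text \<open>
  A function on the reals has at most one continuous representative. It exists for every element of
  \<open>fourier_eigenspace l \<inter> wiener_space\<close>, by Fourier inversion.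
\<close>

definition continuous_rep :: "(real \<Rightarrow> complex) \<Rightarrow> real \<Rightarrow> complex" where
  "continuous_rep g = (THE h. continuous_on UNIV h \<and> (AE x in lborel. h x = g x))"

definition zak :: "real \<Rightarrow> (real \<Rightarrow> complex) \<Rightarrow> real \<Rightarrow> real \<Rightarrow> complex" where
  "zak a f x \<gamma> =
     sqrt a * (\<Sum>\<^sub>\<infinity>k::int. f (a * (x + of_int k)) * exp (- 2 * pi * \<i> * of_int k * \<gamma>))"

end

theory Submission
  imports Defs
begin

text \<open>
  Let \<open>N = s\<^sup>2\<close> and \<open>c = (-\<i>)^l\<close>, so that the continuous representative \<open>h\<close> of \<open>g\<close> satisfies
  \<open>fourier h = c h\<close> pointwise. At frequency 0 the Zak transform is a periodization of \<open>h\<close>, and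
  Poisson summation turns the sum over the lattice of step \<open>a\<close> into a sum of \<open>fourier h = c h\<close>
  over the lattice of step \<open>1 / a\<close>. For \<open>a = s \<lambda>\<close> and the sampling points \<open>p / N\<close>, write the summation
  index as \<open>n = N k + r\<close>: because \<open>N / s = s\<close>, the points \<open>n / (s \<lambda>) = (s / \<lambda>) (k + r / N)\<close> are the ones
  at which the Zak transform with parameter \<open>s / \<lambda>\<close> samples \<open>h\<close>. Hence the vector of samples for
  \<open>s \<lambda>\<close> is \<open>c / s\<close> times the discrete Fourier transform on the cyclic group of order \<open>N\<close> of the
  vector of samples for \<open>s / \<lambda>\<close> (\<open>lattice_sum_transform\<close>).

  For odd \<open>l\<close> the function \<open>h\<close> is odd, and therefore so are the sample vectors. The odd vectors on
  the cyclic groups of order 3 and 4 form a line, spanned by an eigenvector of the discrete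
  transform with eigenvalue \<open>\<i> sqrt N = \<i> s\<close> (\<open>fourier_odd_vector_3_4\<close>). The total factor is
  \<open>c \<i>\<close>, which is 1 for \<open>l = 1\<close> and -1 for \<open>l = 3\<close>.

  Three analytic facts support this. Membership in the eigenspace is a statement about limits in
  the square mean; testing it against indicators of intervals shows that the Fourier integral of
  \<open>g\<close> equals \<open>c g\<close> almost everywhere, which also provides the continuous representative
  (\<open>L2_fourier_eq_fourier_AE\<close>, \<open>eigenspace_continuous_rep\<close>). The Wiener condition dominates \<open>h\<close> by a
  summable step function, so all lattice sums converge absolutely and locally uniformly, and since
  \<open>fourier h = c h\<close> the dual lattice sums do as well; Poisson summation then holds
  pointwise by uniqueness of Fourier coefficients (\<open>poisson_summation\<close>). Oddness of \<open>h\<close> holds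
  because the transform is symmetric for the inner product on even functions and so has no
  imaginary eigenvalue there (\<open>even_imaginary_eigenfunction_eq_0\<close>).
\<close>

section \<open>The Fourier integral\<close>

lemma fourier_cis: "fourier f \<gamma> = (LINT x|lborel. f x * cis (- (2 * pi * \<gamma> * x)))"
  unfolding fourier_def by (simp add: cis_conv_exp mult_ac)

lemma open_eq_empty_if_AE_not_in:
  fixes U :: "real set"
  assumes "open U" and ae: "AE x in lborel. x \<notin> U"
  shows "U = {}"
proof (rule ccontr)
  assume "U \<noteq> {}"
  have "U \<in> null_sets lborel"
    using ae \<open>open U\<close> by (subst AE_iff_null_sets) auto
  then have "negligible U"
    by (simp add: negligible_iff_null_sets null_sets_completionI)
  with \<open>open U\<close> \<open>U \<noteq> {}\<close> show False
    using open_not_negligible by blast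
qed

lemma continuous_AE_eq_imp_eq:
  fixes f g :: "real \<Rightarrow> complex"
  assumes "continuous_on UNIV f" "continuous_on UNIV g" "AE x in lborel. f x = g x"
  shows "f = g"
proof -
  have "{x. f x \<noteq> g x} = {}"
    using assms by (intro open_eq_empty_if_AE_not_in open_Collect_neq) auto
  then show ?thesis by auto
qed

lemma integrable_mult_cis:
  fixes f :: "real \<Rightarrow> complex"
  assumes "integrable lborel f"
  shows "integrable lborel (\<lambda>x. f x * cis (c * x))"
proof (rule Bochner_Integration.integrable_bound[OF assms])
  show "(\<lambda>x. f x * cis (c * x)) \<in> borel_measurable lborel"
    using assms unfolding cis_conv_exp by measurable
qed (simp add: norm_mult)

text \<open>
  Dominated convergence, with the norm of \<open>f\<close> as the dominating function.
\<close>

lemma continuous_on_fourier: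
  assumes [measurable]: "integrable lborel f"
  shows "continuous_on UNIV (fourier f)"
proof (rule continuous_on_sequentiallyI)
  fix u :: "nat \<Rightarrow> real" and a assume u: "u \<longlonglongrightarrow> a"
  show "(\<lambda>n. fourier f (u n)) \<longlonglongrightarrow> fourier f a"
    unfolding fourier_cis
  proof (rule integral_dominated_convergence[where w="\<lambda>x. norm (f x)"])
    show "(\<lambda>x. f x * cis (- (2 * pi * a * x))) \<in> borel_measurable lborel"
      unfolding cis_conv_exp by measurable
    show "(\<lambda>x. f x * cis (- (2 * pi * u n * x))) \<in> borel_measurable lborel" for n
      unfolding cis_conv_exp by measurable
    show "AE x in lborel. (\<lambda>n. f x * cis (- (2 * pi * u n * x))) \<longlonglongrightarrow> f x * cis (- (2 * pi * a * x))"
      using u by (intro AE_I2 tendsto_intros)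
  qed (use assms in \<open>auto simp: norm_mult\<close>)
qed

lemma integrable_fourier_kernel:
  assumes [measurable]: "integrable lborel f" "integrable lborel g"
  shows "integrable (lborel \<Otimes>\<^sub>M lborel) (\<lambda>(x, y). f x * g y * cis (- (2 * pi * x * y)))"
proof (rule lborel_pair.Fubini_integrable)
  show "(\<lambda>(x, y). f x * g y * cis (- (2 * pi * x * y))) \<in> borel_measurable (lborel \<Otimes>\<^sub>M lborel)"
    unfolding cis_conv_exp by measurable
  show "integrable lborel (\<lambda>x. LINT y|lborel. norm (case (x, y) of (x, y) \<Rightarrow> f x * g y * cis (- (2 * pi * x * y))))"
    using assms by (simp add: norm_mult)
  show "AE x in lborel. integrable lborel (\<lambda>y. case (x, y) of (x, y) \<Rightarrow> f x * g y * cis (- (2 * pi * x * y)))"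
  proof (rule AE_I2)
    fix x
    show "integrable lborel (\<lambda>y. case (x, y) of (x, y) \<Rightarrow> f x * g y * cis (- (2 * pi * x * y)))"
      using integrable_mult_cis[of "\<lambda>y. f x * g y" "- (2 * pi * x)"] assms by (simp add: mult_ac)
  qed
qed

text \<open>
  The kernel is symmetric in its two variables, so this is Fubini's theorem.
\<close>

lemma fourier_duality:
  assumes f: "integrable lborel f" and g: "integrable lborel g"
  shows "(LINT x|lborel. fourier f x * g x) = (LINT x|lborel. f x * fourier g x)"
proof -
  have "(LINT x|lborel. f x * fourier g x)
      = (LINT x|lborel. LINT y|lborel. f x * g y * cis (- (2 * pi * x * y)))"
    unfolding fourier_cis by (simp add: mult.assoc)
  also have "\<dots> = (LINT y|lborel. LINT x|lborel. f x * g y * cis (- (2 * pi * x * y)))"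
    by (rule lborel_pair.Fubini_integral[symmetric, OF integrable_fourier_kernel[OF f g]])
  also have "\<dots> = (LINT y|lborel. fourier f y * g y)"
  proof (rule Bochner_Integration.integral_cong[OF refl])
    fix y
    have "(LINT x|lborel. f x * g y * cis (- (2 * pi * x * y)))
        = (LINT x|lborel. f x * cis (- (2 * pi * y * x)) * g y)"
      by (simp add: mult_ac)
    then show "(LINT x|lborel. f x * g y * cis (- (2 * pi * x * y))) = fourier f y * g y"
      unfolding fourier_cis by simp
  qed
  finally show ?thesis ..
qed


section \<open>Agreement of the extended transform and the Fourier integral\<close>

lemma L2_measurable: "f \<in> L2 \<Longrightarrow> f \<in> borel_measurable borel"
  by (simp add: L2_def)

lemma L2_diff:
  assumes "f \<in> L2" "g \<in> L2"
  shows "(\<lambda>x. f x - g x) \<in> L2"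
proof -
  note [measurable] = assms[THEN L2_measurable]
  have "integrable lborel (\<lambda>x. (norm (f x - g x))\<^sup>2)"
  proof (rule Bochner_Integration.integrable_bound)
    show "integrable lborel (\<lambda>x. 2 * (norm (f x))\<^sup>2 + 2 * (norm (g x))\<^sup>2)"
      using assms by (auto simp: L2_def)
    have "(norm (f x - g x))\<^sup>2 \<le> 2 * (norm (f x))\<^sup>2 + 2 * (norm (g x))\<^sup>2" for x
    proof -
      have "(norm (f x - g x))\<^sup>2 \<le> (norm (f x) + norm (g x))\<^sup>2"
        by (intro power_mono norm_triangle_ineq4) auto
      also have "\<dots> \<le> 2 * (norm (f x))\<^sup>2 + 2 * (norm (g x))\<^sup>2"
        using zero_le_power2[of "norm (f x) - norm (g x)"] by (simp add: power2_eq_square algebra_simps)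
      finally show ?thesis .
    qed
    then show "AE x in lborel. norm ((norm (f x - g x))\<^sup>2) \<le> norm (2 * (norm (f x))\<^sup>2 + 2 * (norm (g x))\<^sup>2)"
      by auto
  qed auto
  then show ?thesis by (simp add: L2_def)
qed

lemma L2_Cauchy_Schwarz:
  assumes "f \<in> L2" "g \<in> L2"
  shows "integrable lborel (\<lambda>x. f x * g x)"
    and "norm (LINT x|lborel. f x * g x) \<le> L2norm f * L2norm g"
proof -
  note [measurable] = assms[THEN L2_measurable]
  let ?I = "\<integral>\<^sup>+x. ennreal (norm (f x * g x)) \<partial>lborel"
  have *: "(\<integral>\<^sup>+x. (ennreal (norm (h x)))\<^sup>2 \<partial>lborel) = ennreal ((L2norm h)\<^sup>2)" if "h \<in> L2" for h
    using that unfolding L2norm_def L2_def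
    by (simp add: ennreal_power nn_integral_eq_integral)
  have "?I\<^sup>2 \<le> ennreal ((L2norm f)\<^sup>2) * ennreal ((L2norm g)\<^sup>2)"
    using Cauchy_Schwarz_nn_integral[of "\<lambda>x. ennreal (norm (f x))" lborel "\<lambda>x. ennreal (norm (g x))"]
    by (simp add: * assms norm_mult ennreal_mult)
  also have "\<dots> = ennreal ((L2norm f * L2norm g)\<^sup>2)"
    by (simp add: ennreal_mult[symmetric] power_mult_distrib)
  finally have I2: "?I\<^sup>2 \<le> ennreal ((L2norm f * L2norm g)\<^sup>2)" .
  then have "?I\<^sup>2 < top" using le_less_trans ennreal_less_top by blast
  then have "?I < top" by (simp add: power_less_top_ennreal)
  then obtain r where r: "?I = ennreal r" "0 \<le> r"
    by (cases ?I) auto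
  have "r \<le> L2norm f * L2norm g"
  proof (rule power2_le_imp_le)
    show "r\<^sup>2 \<le> (L2norm f * L2norm g)\<^sup>2"
      using I2 r by (simp add: ennreal_power)
  qed (simp add: L2norm_def)
  then have I: "?I \<le> ennreal (L2norm f * L2norm g)"
    unfolding r by (rule ennreal_leI)
  show int: "integrable lborel (\<lambda>x. f x * g x)"
    using I by (intro integrableI_bounded) (auto intro: le_less_trans)
  have "ennreal (norm (LINT x|lborel. f x * g x)) \<le> ?I"
    by (rule integral_norm_bound_ennreal[OF int])
  with I have "ennreal (norm (LINT x|lborel. f x * g x)) \<le> ennreal (L2norm f * L2norm g)"
    by order
  then show "norm (LINT x|lborel. f x * g x) \<le> L2norm f * L2norm g"
    by (subst (asm) ennreal_le_iff) (auto simp: L2norm_def)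
qed

text \<open>
  Convergence in the square mean implies weak convergence. It is what carries
  \<open>fourier_duality\<close> from the approximating functions to their limits.
\<close>

lemma L2_limit_integral:
  assumes u: "\<And>n. u n \<in> L2" and "f \<in> L2" "\<phi> \<in> L2"
    and lim: "(\<lambda>n. L2norm (\<lambda>x. u n x - f x)) \<longlonglongrightarrow> 0"
  shows "(\<lambda>n. LINT x|lborel. u n x * \<phi> x) \<longlonglongrightarrow> (LINT x|lborel. f x * \<phi> x)"
proof -
  have "(\<lambda>n. (LINT x|lborel. u n x * \<phi> x) - (LINT x|lborel. f x * \<phi> x)) \<longlonglongrightarrow> 0"
  proof (rule Lim_null_comparison)
    show "(\<lambda>n. L2norm (\<lambda>x. u n x - f x) * L2norm \<phi>) \<longlonglongrightarrow> 0"
      using lim by (rule tendsto_mult_left_zero)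
    show "\<forall>\<^sub>F n in sequentially. norm ((LINT x|lborel. u n x * \<phi> x) - (LINT x|lborel. f x * \<phi> x))
        \<le> L2norm (\<lambda>x. u n x - f x) * L2norm \<phi>"
      using L2_Cauchy_Schwarz(2)[OF L2_diff[OF u \<open>f \<in> L2\<close>] \<open>\<phi> \<in> L2\<close>]
      by (simp add: left_diff_distrib L2_Cauchy_Schwarz(1) assms)
  qed
  then show ?thesis by (simp add: LIM_zero_iff)
qed

lemma integrable_inverse_1_plus_square_lborel:
  "integrable lborel (\<lambda>x::real. inverse (1 + x\<^sup>2))"
  using integrable_inverse_1_plus_square by (simp add: set_integrable_def)

lemma fourier_indicator_eq:
  assumes "a \<le> b" "\<gamma> \<noteq> 0"
  shows "fourier (\<lambda>x. indicator {a..b} x) \<gamma>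
    = (cis (- (2 * pi * \<gamma> * b)) - cis (- (2 * pi * \<gamma> * a))) / (- 2 * pi * \<i> * \<gamma>)"
proof -
  let ?e = "\<lambda>x. cis (- (2 * pi * \<gamma> * x))"
  have "(?e has_integral ?e b / (- 2 * pi * \<i> * \<gamma>) - ?e a / (- 2 * pi * \<i> * \<gamma>)) {a..b}"
  proof (rule fundamental_theorem_of_calculus[OF \<open>a \<le> b\<close>])
    fix x assume "x \<in> {a..b}"
    show "((\<lambda>x. ?e x / (- 2 * pi * \<i> * \<gamma>)) has_vector_derivative ?e x) (at x within {a..b})"
      using \<open>\<gamma> \<noteq> 0\<close> unfolding has_vector_derivative_def
      by (auto intro!: derivative_eq_intros simp: scaleR_conv_of_real field_simps)
  qed
  moreover have "set_integrable lborel {a..b} ?e"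
    by (intro borel_integrable_atLeastAtMost') (auto intro!: continuous_intros)
  ultimately have "(LINT x:{a..b}|lborel. ?e x) = ?e b / (- 2 * pi * \<i> * \<gamma>) - ?e a / (- 2 * pi * \<i> * \<gamma>)"
    using set_borel_integral_eq_integral(2) by (metis integral_unique)
  moreover have "(LINT x:{a..b}|lborel. ?e x) = fourier (\<lambda>x. indicator {a..b} x) \<gamma>"
    unfolding fourier_cis set_lebesgue_integral_def
    by (intro Bochner_Integration.integral_cong) (auto simp: indicator_def)
  ultimately show ?thesis by (simp add: diff_divide_distrib)
qed

lemma integrable_indicator_Icc: "integrable lborel (\<lambda>x. indicator {a..b::real} x :: complex)"
proof -
  have "integrable lborel (\<lambda>x. complex_of_real (indicator {a..b} x))"
    by (intro integrable_of_real integrable_real_indicator) (cases "a \<le> b"; simp)+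
  then show ?thesis
    by (rule Bochner_Integration.integrable_cong[THEN iffD1, rotated -1]) (auto simp: indicator_def)
qed

lemma indicator_in_L2: "(\<lambda>x. indicator {a..b} x) \<in> L2"
proof -
  have "(\<lambda>x. (norm (indicator {a..b} x :: complex))\<^sup>2) = (\<lambda>x. indicator {a..b} x :: real)"
    by (auto simp: indicator_def)
  moreover have "integrable lborel (indicator {a..b} :: real \<Rightarrow> real)"
    by (intro integrable_real_indicator) (cases "a \<le> b"; simp)+
  ultimately show ?thesis by (simp add: L2_def)
qed

text \<open>
  The transform of an indicator is a sinc function: it is bounded by the length of the interval,
  and it decays like the reciprocal of its argument. The two bounds together give a multiple
  of the integrable function \<open>inverse (1 + \<gamma>\<^sup>2)\<close> for the square.
\<close>

lemma fourier_indicator_in_L2: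
  assumes "a \<le> b"
  shows "fourier (\<lambda>x. indicator {a..b} x) \<in> L2"
proof -
  let ?F = "fourier (\<lambda>x. indicator {a..b} x)"
  have [measurable]: "?F \<in> borel_measurable borel"
    by (intro borel_measurable_continuous_onI continuous_on_fourier integrable_indicator_Icc)
  have bd1: "norm (?F \<gamma>) \<le> b - a" for \<gamma>
  proof -
    have "norm (?F \<gamma>) \<le> (LINT x|lborel. norm (indicator {a..b} x * cis (- (2 * pi * \<gamma> * x))))"
      unfolding fourier_cis by (rule integral_norm_bound)
    also have "\<dots> = (LINT x|lborel. indicator {a..b} x)"
      by (intro Bochner_Integration.integral_cong) (auto simp: norm_mult indicator_def)
    also have "\<dots> = b - a" using assms by simp
    finally show ?thesis .
  qed
  have bd2: "norm (\<gamma> * ?F \<gamma>) \<le> 1" for \<gamma>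
  proof (cases "\<gamma> = 0")
    case False
    have "norm (\<gamma> * ?F \<gamma>) = norm (cis (- (2 * pi * \<gamma> * b)) - cis (- (2 * pi * \<gamma> * a))) / (2 * pi)"
      using False by (simp add: fourier_indicator_eq[OF assms False] norm_mult norm_divide)
    also have "\<dots> \<le> (norm (cis (- (2 * pi * \<gamma> * b))) + norm (cis (- (2 * pi * \<gamma> * a)))) / (2 * pi)"
      by (intro divide_right_mono norm_triangle_ineq4) auto
    also have "\<dots> \<le> 1" using pi_gt3 by simp
    finally show ?thesis .
  qed simp
  have "integrable lborel (\<lambda>\<gamma>. (norm (?F \<gamma>))\<^sup>2)"
  proof (rule Bochner_Integration.integrable_bound)
    show "integrable lborel (\<lambda>\<gamma>::real. ((b - a)\<^sup>2 + 1) * inverse (1 + \<gamma>\<^sup>2))"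
      by (intro integrable_mult_right integrable_inverse_1_plus_square_lborel)
    have "(norm (?F \<gamma>))\<^sup>2 \<le> ((b - a)\<^sup>2 + 1) * inverse (1 + \<gamma>\<^sup>2)" for \<gamma>
    proof -
      have "(norm (?F \<gamma>))\<^sup>2 \<le> (b - a)\<^sup>2"
        by (intro power_mono bd1) auto
      moreover have "\<gamma>\<^sup>2 * (norm (?F \<gamma>))\<^sup>2 \<le> 1"
        using power_mono[OF bd2[of \<gamma>], of 2] by (simp add: norm_mult power_mult_distrib)
      ultimately have "(1 + \<gamma>\<^sup>2) * (norm (?F \<gamma>))\<^sup>2 \<le> (b - a)\<^sup>2 + 1"
        by (simp add: algebra_simps)
      then show ?thesis
        by (simp add: field_simps add_pos_nonneg)
    qed
    then show "AE \<gamma> in lborel. norm ((norm (?F \<gamma>))\<^sup>2) \<le> norm (((b - a)\<^sup>2 + 1) * inverse (1 + \<gamma>\<^sup>2))"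
      by (auto simp: abs_mult)
  qed auto
  then show ?thesis by (simp add: L2_def)
qed

text \<open>
  Lebesgue differentiation: almost everywhere a function is the limit of its averages over
  shrinking intervals, and here all of these vanish.
\<close>

lemma AE_eq_0_if_integral_Icc_0:
  fixes f :: "real \<Rightarrow> complex"
  assumes int: "\<And>a b. a \<le> b \<Longrightarrow> integrable lborel (\<lambda>x. f x * indicator {a..b} x)"
    and 0: "\<And>a b. a \<le> b \<Longrightarrow> (LINT x|lborel. f x * indicator {a..b} x) = 0"
  shows "AE x in lborel. f x = 0"
proof -
  have set_int: "set_integrable lborel {a..b} f" if "a \<le> b" for a b
    using int[OF that] unfolding set_integrable_def
    by (rule Bochner_Integration.integrable_cong[THEN iffD1, rotated -1]) (auto simp: indicator_def)
  have HK: "(f has_integral 0) {a..b}" if "a \<le> b" for a b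
  proof -
    have "(LINT x:{a..b}|lborel. f x) = (LINT x|lborel. f x * indicator {a..b} x)"
      unfolding set_lebesgue_integral_def
      by (intro Bochner_Integration.integral_cong) (auto simp: indicator_def)
    then show ?thesis
      using set_borel_integral_eq_integral[OF set_int[OF that]] 0[OF that]
      by (metis has_integral_integral)
  qed
  have "f integrable_on cbox a b" for a b
    using HK[of a b] by (cases "a \<le> b") auto
  then obtain N where N: "negligible N"
    and lim: "\<And>x e. \<lbrakk>x \<notin> N; 0 < e\<rbrakk> \<Longrightarrow> \<exists>d>0. \<forall>h. 0 < h \<and> h < d \<longrightarrow>
        norm (integral (cbox x (x + h *\<^sub>R One)) f /\<^sub>R h ^ DIM(real) - f x) < e"
    using integrable_ccontinuous_explicit by metis
  have "f x = 0" if "x \<notin> N" for x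
  proof (rule ccontr)
    assume "f x \<noteq> 0"
    then have "0 < norm (f x)" by simp
    from lim[OF that this] obtain d where "d > 0" and d: "\<forall>h. 0 < h \<and> h < d \<longrightarrow>
        norm (integral (cbox x (x + h *\<^sub>R One)) f /\<^sub>R h ^ DIM(real) - f x) < norm (f x)"
      by blast
    have "integral {x..x + d/2} f = 0"
      using HK[of x "x + d/2"] \<open>d > 0\<close> by auto
    then show False using spec[OF d, of "d/2"] \<open>d > 0\<close> by simp
  qed
  then have "{x. f x \<noteq> 0} \<subseteq> N" by auto
  then have "negligible {x. f x \<noteq> 0}" using N negligible_subset by blast
  then have "AE x in lebesgue. f x = 0"
    by (intro AE_I'[of "{x. f x \<noteq> 0}"]) (auto simp: negligible_iff_null_sets)
  then show ?thesis by (simp add: AE_completion_iff)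
qed

text \<open>
  Both functions have the same integral over each interval. Indeed, if \<open>u n\<close> tends to \<open>f\<close> and
  \<open>fourier (u n)\<close> to \<open>F\<close>, then the integral of \<open>fourier (u n)\<close> against an indicator \<open>\<phi>\<close> tends to
  that of \<open>F\<close>, and by duality it is the integral of \<open>u n\<close> against \<open>fourier \<phi>\<close>, which tends to that
  of \<open>f\<close> against \<open>fourier \<phi>\<close>. Another use of duality, possible because \<open>f\<close> is integrable, brings
  the transform back to \<open>f\<close>. Indicators suit this because they and their transforms
  are square-integrable.
\<close>

lemma L2_fourier_eq_fourier_AE:
  assumes rel: "is_L2_fourier f F" and f: "integrable lborel f"
  shows "AE x in lborel. F x = fourier f x"
proof -
  from rel obtain u where "f \<in> L2" "F \<in> L2"
    and u: "\<And>n. integrable lborel (u n)" "\<And>n. u n \<in> L2" "\<And>n. fourier (u n) \<in> L2"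
    and lim: "(\<lambda>n. L2norm (\<lambda>x. u n x - f x)) \<longlonglongrightarrow> 0"
      "(\<lambda>n. L2norm (\<lambda>\<gamma>. fourier (u n) \<gamma> - F \<gamma>)) \<longlonglongrightarrow> 0"
    unfolding is_L2_fourier_def by blast
  have intF: "integrable lborel (\<lambda>x. F x * indicator {a..b} x)" for a b
    by (intro L2_Cauchy_Schwarz \<open>F \<in> L2\<close> indicator_in_L2)
  have intf: "integrable lborel (\<lambda>x. fourier f x * indicator {a..b} x)" for a b
    using borel_integrable_atLeastAtMost'[OF continuous_on_subset[OF continuous_on_fourier[OF f]], of a b]
    unfolding set_integrable_def
    by (rule Bochner_Integration.integrable_cong[THEN iffD1, rotated -1]) (auto simp: indicator_def)
  have eq: "(LINT x|lborel. F x * indicator {a..b} x) = (LINT x|lborel. fourier f x * indicator {a..b} x)"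
    if "a \<le> b" for a b
  proof (rule LIMSEQ_unique)
    show "(\<lambda>n. LINT x|lborel. fourier (u n) x * indicator {a..b} x) \<longlonglongrightarrow> (LINT x|lborel. F x * indicator {a..b} x)"
      by (intro L2_limit_integral u \<open>F \<in> L2\<close> indicator_in_L2 lim)
    have "(\<lambda>n. LINT x|lborel. u n x * fourier (indicator {a..b}) x)
        \<longlonglongrightarrow> (LINT x|lborel. f x * fourier (indicator {a..b}) x)"
      by (intro L2_limit_integral u \<open>f \<in> L2\<close> fourier_indicator_in_L2 that lim)
    then show "(\<lambda>n. LINT x|lborel. fourier (u n) x * indicator {a..b} x)
        \<longlonglongrightarrow> (LINT x|lborel. fourier f x * indicator {a..b} x)"
      by (simp add: fourier_duality u f integrable_indicator_Icc)
  qed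
  have "AE x in lborel. F x - fourier f x = 0"
    by (rule AE_eq_0_if_integral_Icc_0)
      (auto simp: left_diff_distrib intF intf eq)
  then show ?thesis by simp
qed

section \<open>Wiener amalgam bounds\<close>

text \<open>
  The half-open unit intervals with integer end points, enumerated by the natural numbers so that
  countable additivity of the integral applies to them directly.
\<close>

definition unit_cell :: "nat \<Rightarrow> real set" where
  "unit_cell n = {real_of_int (int_decode n)..<real_of_int (int_decode n) + 1}"

lemma mem_unit_cell_iff: "x \<in> unit_cell n \<longleftrightarrow> \<lfloor>x\<rfloor> = int_decode n"
  by (auto simp: unit_cell_def floor_eq_iff)

lemma UN_unit_cell: "(\<Union>n. unit_cell n) = UNIV"
  using mem_unit_cell_iff surj_int_decode by (metis UNIV_eq_I UN_I UNIV_I surjD)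

lemma disjoint_unit_cell: "disjoint_family unit_cell"
  by (auto simp: disjoint_family_on_def mem_unit_cell_iff dest: injD[OF inj_int_decode])

text \<open>
  The integral of the step function \<open>b \<lfloor>x\<rfloor>\<close> is the sum of \<open>b\<close>.
\<close>

lemma integrable_if_floor_bound:
  fixes f :: "real \<Rightarrow> complex" and b :: "int \<Rightarrow> real"
  assumes [measurable]: "f \<in> borel_measurable lborel"
    and b: "\<And>k. 0 \<le> b k" "b summable_on UNIV"
    and bound: "AE x in lborel. norm (f x) \<le> b \<lfloor>x\<rfloor>"
  shows "integrable lborel f"
proof (rule integrableI_bounded)
  have "(\<lambda>n. b (int_decode n)) summable_on UNIV"
    using b(2) summable_on_reindex_bij_betw[OF bij_int_decode, of b] by simp
  then have sb: "summable (\<lambda>n. b (int_decode n))"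
    by (rule summable_on_imp_summable)
  have "(\<integral>\<^sup>+x. ennreal (norm (f x)) \<partial>lborel) \<le> (\<integral>\<^sup>+x. ennreal (b \<lfloor>x::real\<rfloor>) \<partial>lborel)"
  proof (rule nn_integral_mono_AE)
    show "AE x in lborel. ennreal (norm (f x)) \<le> ennreal (b \<lfloor>x\<rfloor>)"
      using bound by eventually_elim (rule ennreal_leI)
  qed
  also have "\<dots> = (\<integral>\<^sup>+x\<in>(\<Union>n. unit_cell n). ennreal (b \<lfloor>x\<rfloor>) \<partial>lborel)"
    unfolding UN_unit_cell by simp
  also have "\<dots> = (\<Sum>n. \<integral>\<^sup>+x\<in>unit_cell n. ennreal (b \<lfloor>x\<rfloor>) \<partial>lborel)"
    by (intro nn_integral_disjoint_family disjoint_unit_cell) (auto simp: unit_cell_def)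
  also have "\<dots> = (\<Sum>n. ennreal (b (int_decode n)))"
  proof (rule suminf_cong)
    fix n
    have "(\<integral>\<^sup>+x\<in>unit_cell n. ennreal (b \<lfloor>x\<rfloor>) \<partial>lborel) = (\<integral>\<^sup>+x. ennreal (b (int_decode n)) * indicator (unit_cell n) x \<partial>lborel)"
      by (intro nn_integral_cong) (auto simp: indicator_def mem_unit_cell_iff)
    also have "\<dots> = ennreal (b (int_decode n)) * emeasure lborel (unit_cell n)"
      by (intro nn_integral_cmult_indicator) (auto simp: unit_cell_def)
    finally show "(\<integral>\<^sup>+x\<in>unit_cell n. ennreal (b \<lfloor>x\<rfloor>) \<partial>lborel) = ennreal (b (int_decode n))"
      by (simp add: unit_cell_def)
  qed
  also have "\<dots> < \<infinity>"
    using b(1) sb by (simp add: suminf_ennreal2)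
  finally show "(\<integral>\<^sup>+x. ennreal (norm (f x)) \<partial>lborel) < \<infinity>" .
qed fact

text \<open>
  The essential suprema in the Wiener norm serve as \<open>b\<close>. The step function turns the
  family of bounds on unit intervals into a single pointwise bound.
\<close>

lemma wiener_space_floor_bound:
  assumes "g \<in> wiener_space"
  obtains b :: "int \<Rightarrow> real" where "\<And>k. 0 \<le> b k" "b summable_on UNIV"
    "AE x in lborel. norm (g x) \<le> b \<lfloor>x\<rfloor>"
proof
  define E where "E k = esssup (restrict_space lborel {0..1}) (\<lambda>x. ennreal (norm (g (x + of_int k))))" for k :: int
  have [measurable]: "g \<in> borel_measurable lborel" and fin: "(\<Sum>\<^sub>\<infinity>k. E k) < \<infinity>"
    using assms by (auto simp: wiener_space_def E_def)
  have "(\<Sum>\<^sub>\<infinity>k. E k) = (SUP F\<in>{F. finite F \<and> F \<subseteq> UNIV}. sum E F)"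
    by (rule nonneg_infsum_complete) simp
  then have partial: "sum E F \<le> (\<Sum>\<^sub>\<infinity>k. E k)" if "finite F" for F
    using that by (auto intro: SUP_upper)
  have E_fin: "E k < \<infinity>" for k
    using partial[of "{k}"] fin by simp
  show "0 \<le> enn2real (E k)" for k by simp
  show "(\<lambda>k. enn2real (E k)) summable_on UNIV"
  proof (rule nonneg_bdd_above_summable_on)
    show "bdd_above (sum (\<lambda>k. enn2real (E k)) ` {F. F \<subseteq> UNIV \<and> finite F})"
    proof (rule bdd_aboveI2)
      fix F assume "F \<in> {F. F \<subseteq> (UNIV :: int set) \<and> finite F}"
      then have "finite F" by simp
      have "(\<Sum>k\<in>F. enn2real (E k)) = enn2real (sum E F)"
        using E_fin by (simp add: enn2real_sum)
      also have "\<dots> \<le> enn2real (\<Sum>\<^sub>\<infinity>k. E k)"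
        using partial[OF \<open>finite F\<close>] fin by (intro enn2real_mono) auto
      finally show "(\<Sum>k\<in>F. enn2real (E k)) \<le> enn2real (\<Sum>\<^sub>\<infinity>k. E k)" .
    qed
  qed simp
  have "AE x in lborel. - of_int k + 1 * x \<in> {0..1} \<longrightarrow> norm (g (- of_int k + 1 * x + of_int k)) \<le> enn2real (E k)"
    for k :: int
  proof (rule AE_borel_affine)
    have "AE x in restrict_space lborel {0..1}. ennreal (norm (g (x + of_int k))) \<le> E k"
      unfolding E_def by (rule esssup_AE)
    then show "AE x in lborel. x \<in> {0..1} \<longrightarrow> norm (g (x + of_int k)) \<le> enn2real (E k)"
      using E_fin[of k]
      by (auto simp: AE_restrict_space_iff elim!: eventually_mono)
        (metis ennreal_enn2real ennreal_le_iff enn2real_nonneg infinity_ennreal_def)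
  qed (measurable; simp)+
  then have "AE x in lborel. \<forall>k::int. - of_int k + 1 * x \<in> {0..1} \<longrightarrow>
      norm (g (- of_int k + 1 * x + of_int k)) \<le> enn2real (E k)"
    by (simp add: AE_all_countable)
  then show "AE x in lborel. norm (g x) \<le> enn2real (E \<lfloor>x\<rfloor>)"
  proof eventually_elim
    case (elim x)
    have "- of_int \<lfloor>x\<rfloor> + 1 * x \<in> {0..1}" by simp linarith
    with spec[OF elim, of "\<lfloor>x\<rfloor>"] show ?case by simp
  qed
qed

text \<open>
  Right-hand limits suffice to pass from almost all points to all points: every \<open>y > x\<close>
  close to \<open>x\<close> lies in the same cell \<open>\<lfloor>y\<rfloor> = \<lfloor>x\<rfloor>\<close>, also when \<open>x\<close> is an integer.
\<close>

lemma continuous_floor_bound: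
  fixes h :: "real \<Rightarrow> complex" and b :: "int \<Rightarrow> real"
  assumes h: "continuous_on UNIV h" and ae: "AE x in lborel. norm (h x) \<le> b \<lfloor>x\<rfloor>"
  shows "norm (h x) \<le> b \<lfloor>x\<rfloor>"
proof -
  define U where "U = {x<..<of_int \<lfloor>x\<rfloor> + 1} \<inter> {y. b \<lfloor>x\<rfloor> < norm (h y)}"
  have "U = {}"
  proof (rule open_eq_empty_if_AE_not_in)
    show "open U" unfolding U_def
      using h by (intro open_Int open_Collect_less continuous_intros) auto
    show "AE y in lborel. y \<notin> U"
      using ae
    proof eventually_elim
      case (elim y)
      have "\<lfloor>y\<rfloor> = \<lfloor>x\<rfloor>" if "y \<in> U"
      proof (rule floor_unique)
        have "x < y" "y < of_int \<lfloor>x\<rfloor> + 1" using that by (auto simp: U_def)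
        then show "of_int \<lfloor>x\<rfloor> \<le> y" "y < of_int \<lfloor>x\<rfloor> + 1" by linarith+
      qed
      with elim show ?case by (auto simp: U_def)
    qed
  qed
  have "norm (h y) \<le> b \<lfloor>x\<rfloor>" if "x < y" "y < of_int \<lfloor>x\<rfloor> + 1" for y
  proof (rule ccontr)
    assume "\<not> norm (h y) \<le> b \<lfloor>x\<rfloor>"
    with that have "y \<in> U" by (auto simp: U_def)
    with \<open>U = {}\<close> show False by simp
  qed
  moreover have "x < of_int \<lfloor>x\<rfloor> + 1" by simp
  ultimately have "eventually (\<lambda>y. norm (h y) \<le> b \<lfloor>x\<rfloor>) (at_right x)"
    unfolding eventually_at_right[OF \<open>x < _\<close>] by blast
  moreover have "((\<lambda>y. norm (h y)) \<longlongrightarrow> norm (h x)) (at_right x)"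
    using h by (intro tendsto_norm)
      (auto simp: continuous_on_eq_continuous_at isCont_def intro: filterlim_at_split[THEN iffD1, THEN conjunct2])
  ultimately show ?thesis
    using tendsto_upperbound trivial_limit_at_right_real by blast
qed

text \<open>
  Grouping a finite sum by the values of \<open>\<phi>\<close> counts each \<open>b n\<close> at most \<open>M\<close> times.
\<close>

lemma summable_on_compose_bounded_fibres:
  fixes b :: "'b \<Rightarrow> real" and \<phi> :: "'a \<Rightarrow> 'b"
  assumes b: "\<And>n. 0 \<le> b n" "b summable_on UNIV"
    and fib: "\<And>n F. finite F \<Longrightarrow> (\<And>k. k \<in> F \<Longrightarrow> \<phi> k = n) \<Longrightarrow> card F \<le> M"
  shows "(\<lambda>k. b (\<phi> k)) summable_on UNIV"
proof (rule nonneg_bdd_above_summable_on)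
  show "bdd_above (sum (\<lambda>k. b (\<phi> k)) ` {F. F \<subseteq> UNIV \<and> finite F})"
  proof (rule bdd_aboveI2)
    fix F assume "F \<in> {F. F \<subseteq> (UNIV :: 'a set) \<and> finite F}"
    then have "finite F" by simp
    then have "(\<Sum>k\<in>F. b (\<phi> k)) = (\<Sum>n\<in>\<phi> ` F. \<Sum>k\<in>{k\<in>F. \<phi> k = n}. b (\<phi> k))"
      by (rule sum.image_gen)
    also have "\<dots> = (\<Sum>n\<in>\<phi> ` F. real (card {k\<in>F. \<phi> k = n}) * b n)"
      by (intro sum.cong) auto
    also have "\<dots> \<le> (\<Sum>n\<in>\<phi> ` F. real M * b n)"
      using \<open>finite F\<close> by (intro sum_mono mult_right_mono b) (auto intro!: fib)
    also have "\<dots> \<le> real M * (\<Sum>\<^sub>\<infinity>n. b n)"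
      unfolding sum_distrib_left[symmetric]
      using \<open>finite F\<close> b by (intro mult_left_mono finite_sum_le_infsum) auto
    finally show "(\<Sum>k\<in>F. b (\<phi> k)) \<le> real M * (\<Sum>\<^sub>\<infinity>n. b n)" .
  qed
qed (use b in auto)

lemma summable_on_finite_sum:
  fixes f :: "'a \<Rightarrow> 'b \<Rightarrow> 'c :: topological_comm_monoid_add"
  assumes "finite A" "\<And>j. j \<in> A \<Longrightarrow> f j summable_on S"
  shows "(\<lambda>k. \<Sum>j\<in>A. f j k) summable_on S"
  using assms by (induction) (auto intro: summable_on_add)

text \<open>
  The integer translates of \<open>f\<close> have a common summable majorant on each bounded set. Unlike a bound
  by a step function, this condition does not refer to the position of the cells, and it is the
  form in which the Weierstrass test gives a continuous periodization.
\<close>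

definition locally_uniformly_summable :: "(real \<Rightarrow> complex) \<Rightarrow> bool" where
  "locally_uniformly_summable f \<longleftrightarrow>
     (\<forall>R. \<exists>B :: int \<Rightarrow> real. B summable_on UNIV \<and> (\<forall>k x. \<bar>x\<bar> \<le> R \<longrightarrow> norm (f (x + of_int k)) \<le> B k))"

text \<open>
  For \<open>x\<close> in a bounded set, \<open>a (x + k)\<close> lies in a cell whose index differs from \<open>\<lfloor>a k\<rfloor>\<close> by at most a
  constant \<open>J\<close>. The map taking \<open>k\<close> to \<open>\<lfloor>a k\<rfloor>\<close> takes each value at most \<open>\<lceil>1 / a\<rceil> + 1\<close> times,
  so the bounds remain summable after this change of index.
\<close>

lemma locally_uniformly_summable_dilation:
  fixes h :: "real \<Rightarrow> complex" and b :: "int \<Rightarrow> real"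
  assumes "0 < a" and b: "\<And>k. 0 \<le> b k" "b summable_on UNIV"
    and bound: "\<And>x. norm (h x) \<le> b \<lfloor>x\<rfloor>"
  shows "locally_uniformly_summable (\<lambda>x. h (a * x))"
  unfolding locally_uniformly_summable_def
proof (intro allI exI conjI impI)
  fix R :: real
  define J where "J = \<lceil>a * R\<rceil> + 1"
  have card: "card F \<le> nat (\<lceil>1 / a\<rceil> + 1)" if F: "finite F" "\<And>k. k \<in> F \<Longrightarrow> \<lfloor>a * of_int k\<rfloor> + j = n" for F :: "int set" and j n
  proof -
    have "F \<subseteq> {\<lceil>of_int (n - j) / a\<rceil>..\<lceil>of_int (n - j) / a\<rceil> + \<lceil>1 / a\<rceil>}"
    proof
      fix k assume "k \<in> F"
      then have "\<lfloor>a * of_int k\<rfloor> = n - j" using F(2) by fastforce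
      then have "of_int (n - j) \<le> a * of_int k" "a * of_int k < of_int (n - j) + 1"
        by linarith+
      then have 1: "of_int (n - j) / a \<le> of_int k" and 2: "of_int k < of_int (n - j) / a + 1 / a"
        using \<open>0 < a\<close> by (simp_all add: field_simps)
      have "\<lceil>of_int (n - j) / a\<rceil> \<le> k" using 1 by (simp add: ceiling_le)
      moreover have "of_int k \<le> real_of_int (\<lceil>of_int (n - j) / a\<rceil> + \<lceil>1 / a\<rceil>)"
        using 2 by simp linarith
      then have "k \<le> \<lceil>of_int (n - j) / a\<rceil> + \<lceil>1 / a\<rceil>" by linarith
      ultimately show "k \<in> {\<lceil>of_int (n - j) / a\<rceil>..\<lceil>of_int (n - j) / a\<rceil> + \<lceil>1 / a\<rceil>}" by simp
    qed
    from card_mono[OF _ this] show ?thesis by simp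
  qed
  show "(\<lambda>k. \<Sum>j\<in>{-J..J}. b (\<lfloor>a * of_int k\<rfloor> + j)) summable_on UNIV"
    by (intro summable_on_finite_sum) (use card in \<open>auto intro!: summable_on_compose_bounded_fibres[OF b]\<close>)
  fix k :: int and x :: real assume "\<bar>x\<bar> \<le> R"
  then have "\<bar>a * x\<bar> \<le> a * R" using \<open>0 < a\<close> by (simp add: abs_mult)
  moreover define j where "j = \<lfloor>a * (x + of_int k)\<rfloor> - \<lfloor>a * of_int k\<rfloor>"
  ultimately have j: "j \<in> {-J..J}"
    by (auto simp: J_def algebra_simps) linarith+
  have "norm (h (a * (x + of_int k))) \<le> b (\<lfloor>a * of_int k\<rfloor> + j)"
    using bound[of "a * (x + of_int k)"] by (simp add: j_def)
  also have "\<dots> \<le> (\<Sum>j\<in>{-J..J}. b (\<lfloor>a * of_int k\<rfloor> + j))"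
    using j b by (intro member_le_sum) auto
  finally show "norm (h (a * (x + of_int k))) \<le> (\<Sum>j\<in>{-J..J}. b (\<lfloor>a * of_int k\<rfloor> + j))" .
qed

section \<open>Uniqueness of Fourier coefficients\<close>

definition vanishing_coefficients :: "(real \<Rightarrow> complex) \<Rightarrow> bool" where
  "vanishing_coefficients D \<longleftrightarrow> continuous_on {0..1} D \<and>
     (\<forall>n::int. integral {0..1} (\<lambda>x. D x * cis (2 * pi * of_int n * x)) = 0)"

text \<open>
  A linear function of the point \<open>cis t\<close> on the circle is a combination of \<open>cis t\<close> and \<open>cis (- t)\<close>,
  so multiplication by it only shifts the indices of Fourier coefficients. Quantifying over \<open>D\<close>
  makes the case of a product a composition of two multiplications.
\<close>

lemma vanishing_coefficients_times_polynomial: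
  assumes "real_polynomial_function P" and "vanishing_coefficients D"
  shows "vanishing_coefficients (\<lambda>x. D x * of_real (P (cis (2 * pi * x))))"
  using assms
proof (induction arbitrary: D)
  case (linear P)
  interpret P: bounded_linear P by fact
  define \<alpha> where "\<alpha> = (of_real (P 1) - \<i> * of_real (P \<i>)) / 2"
  define \<beta> where "\<beta> = (of_real (P 1) + \<i> * of_real (P \<i>)) / 2"
  have P: "of_real (P (cis t)) = \<alpha> * cis t + \<beta> * cis (- t)" for t
  proof -
    have "cis t = cos t *\<^sub>R 1 + sin t *\<^sub>R \<i>"
      by (simp add: complex_eq_iff)
    then have "P (cis t) = cos t * P 1 + sin t * P \<i>"
      by (simp only: P.add P.scaleR real_scaleR_def)
    then show ?thesis
      by (simp add: \<alpha>_def \<beta>_def complex_eq_iff field_simps)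
  qed
  from linear have D: "continuous_on {0..1} D"
    and 0: "\<And>n::int. integral {0..1} (\<lambda>x. D x * cis (2 * pi * of_int n * x)) = 0"
    by (auto simp: vanishing_coefficients_def)
  have int: "(\<lambda>x. c * (D x * cis (2 * pi * of_int n * x))) integrable_on {0..1}" for c and n :: int
    by (intro integrable_continuous_real continuous_intros D)
  show ?case unfolding vanishing_coefficients_def
  proof (intro conjI allI)
    show "continuous_on {0..1} (\<lambda>x. D x * of_real (P (cis (2 * pi * x))))"
      by (intro continuous_intros D P.continuous_on)
    fix n :: int
    have "(\<lambda>x. D x * of_real (P (cis (2 * pi * x))) * cis (2 * pi * of_int n * x))
        = (\<lambda>x. \<alpha> * (D x * cis (2 * pi * of_int (n + 1) * x)) + \<beta> * (D x * cis (2 * pi * of_int (n - 1) * x)))"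
      by (intro ext) (simp add: P algebra_simps cis_mult)
    then show "integral {0..1} (\<lambda>x. D x * of_real (P (cis (2 * pi * x))) * cis (2 * pi * of_int n * x)) = 0"
      using 0[of "n + 1"] 0[of "n - 1"]
      by (simp only: integral_add[OF int int] integral_mult_right) simp
  qed
next
  case (const c)
  then show ?case
    by (auto simp: vanishing_coefficients_def mult.assoc mult.left_commute[of _ "of_real c"]
        intro!: continuous_intros)
next
  case (add P Q)
  from add.IH[OF add.prems]
  have P: "continuous_on {0..1} (\<lambda>x. D x * of_real (P (cis (2 * pi * x))))"
      "\<And>n::int. integral {0..1} (\<lambda>x. D x * of_real (P (cis (2 * pi * x))) * cis (2 * pi * of_int n * x)) = 0"
    and Q: "continuous_on {0..1} (\<lambda>x. D x * of_real (Q (cis (2 * pi * x))))"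
      "\<And>n::int. integral {0..1} (\<lambda>x. D x * of_real (Q (cis (2 * pi * x))) * cis (2 * pi * of_int n * x)) = 0"
    by (auto simp: vanishing_coefficients_def)
  have "(\<lambda>x. D x * of_real (P (cis (2 * pi * x))) * cis (2 * pi * of_int n * x)) integrable_on {0..1}"
    "(\<lambda>x. D x * of_real (Q (cis (2 * pi * x))) * cis (2 * pi * of_int n * x)) integrable_on {0..1}" for n :: int
    by (intro integrable_continuous_real continuous_intros P(1) Q(1))+
  then show ?case
    using continuous_on_add[OF P(1) Q(1)] P(2) Q(2)
    by (simp add: vanishing_coefficients_def distrib_left distrib_right integral_add)
next
  case (mult P Q)
  show ?case
    using mult.IH(2)[OF mult.IH(1)[OF mult.prems]] by (simp add: mult.assoc)
qed

text \<open>
  The function \<open>\<phi>\<close> is \<open>D\<close> composed with the argument. The argument jumps on the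
  negative real axis, but there \<open>\<phi>\<close> is also \<open>D\<close> composed with the argument of \<open>- z\<close> shifted by half
  a turn, and that is continuous.
\<close>

lemma continuous_function_on_circle:
  fixes D :: "real \<Rightarrow> complex"
  assumes D: "continuous_on UNIV D" and per: "\<And>x m. D (x + of_int m) = D x"
  obtains \<phi> :: "complex \<Rightarrow> complex"
  where "continuous_on (sphere 0 1) \<phi>" "\<And>x. \<phi> (cis (2 * pi * x)) = D x"
proof
  define \<phi> where "\<phi> z = D (Arg z / (2 * pi))" for z
  have well: "D t = D t'" if "cis (2 * pi * t) = cis (2 * pi * t')" for t t'
  proof -
    from that have "exp (\<i> * of_real (2 * pi * t)) = exp (\<i> * of_real (2 * pi * t'))"
      by (simp add: cis_conv_exp)
    then obtain n :: int where "\<i> * of_real (2 * pi * t) = \<i> * of_real (2 * pi * t') + of_int (2 * n) * pi * \<i>"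
      unfolding exp_eq by auto
    then have "Im (\<i> * of_real (2 * pi * t)) = Im (\<i> * of_real (2 * pi * t') + of_int (2 * n) * pi * \<i>)"
      by (rule arg_cong)
    then have "2 * pi * t = 2 * pi * (t' + of_int n)" by (simp add: algebra_simps)
    then have "t = t' + of_int n" by simp
    then show ?thesis using per by simp
  qed
  show val: "\<phi> (cis (2 * pi * x)) = D x" for x
    unfolding \<phi>_def by (intro well) (simp add: cis_Arg sgn_eq)
  have isD: "isCont D x" for x using D by (simp add: continuous_on_eq_continuous_at)
  show "continuous_on (sphere 0 1) \<phi>"
    unfolding continuous_on_eq_continuous_within
  proof
    fix z :: complex assume z: "z \<in> sphere 0 1"
    show "continuous (at z within sphere 0 1) \<phi>"
    proof (cases "z \<in> \<real>\<^sub>\<le>\<^sub>0")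
      case False
      then show ?thesis unfolding \<phi>_def
        by (intro continuous_within_compose3[OF isD] continuous_divide continuous_within_Arg) auto
    next
      case True
      then have "- z \<notin> \<real>\<^sub>\<le>\<^sub>0"
        using z by (auto simp: complex_nonpos_Reals_iff complex_eq_iff norm_complex_def)
      then have "continuous (at z) (\<lambda>w. Arg (- w))"
        unfolding isCont_def by (intro tendsto_Arg tendsto_minus tendsto_ident_at)
      then have "continuous (at z within sphere 0 1) (\<lambda>w. Arg (- w))"
        by (rule continuous_at_imp_continuous_within)
      then have cont: "continuous (at z within sphere 0 1) (\<lambda>w. D ((Arg (- w) + pi) / (2 * pi)))"
        by (intro continuous_within_compose3[OF isD] continuous_divide continuous_add continuous_const) auto
      have eq: "D ((Arg (- w) + pi) / (2 * pi)) = \<phi> w" if "w \<in> sphere 0 1" for w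
        unfolding \<phi>_def
      proof (rule well)
        have "norm w = 1" "w \<noteq> 0" using that by auto
        then have "cis (Arg (- w)) = - w" "cis (Arg w) = w"
          by (simp_all add: cis_Arg sgn_eq)
        then show "cis (2 * pi * ((Arg (- w) + pi) / (2 * pi))) = cis (2 * pi * (Arg w / (2 * pi)))"
          by (simp flip: cis_mult)
      qed
      show ?thesis
        by (rule continuous_transform_within[OF cont zero_less_one z]) (use eq in auto)
    qed
  qed
qed

text \<open>
  \<open>D\<close> is orthogonal to every polynomial in the real coordinates of \<open>cis (2 * pi * x)\<close>. By
  Stone-Weierstrass such polynomials approximate the real and the imaginary part of \<open>D\<close>
  uniformly, so \<open>D\<close> is orthogonal to itself.
\<close>

lemma periodic_eq_0_if_vanishing_coefficients:
  fixes D :: "real \<Rightarrow> complex"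
  assumes D: "continuous_on UNIV D" and per: "\<And>x m. D (x + of_int m) = D x"
    and coeff: "\<And>n::int. integral {0..1} (\<lambda>x. D x * cis (2 * pi * of_int n * x)) = 0"
  shows "D x = 0"
proof -
  obtain \<phi> where \<phi>: "continuous_on (sphere 0 1) \<phi>" and \<phi>_cis: "\<And>x. \<phi> (cis (2 * pi * x)) = D x"
    using continuous_function_on_circle[OF D per] by blast
  have D01: "continuous_on {0..1} D" using D continuous_on_subset by blast
  have vanish: "vanishing_coefficients D"
    using D01 coeff by (simp add: vanishing_coefficients_def)
  obtain C where C: "\<forall>y \<in> D ` {0..1}. norm y \<le> C"
    using compact_imp_bounded[OF compact_continuous_image[OF D01 compact_Icc]]
    unfolding bounded_iff by blast
  then have C: "norm (D x) \<le> C" if "x \<in> {0..1}" for x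
    using that by blast
  have "0 \<le> C" using order_trans[OF norm_ge_zero C[of 0]] by simp
  have small: "norm (integral {0..1} (\<lambda>x. D x * cnj (D x))) \<le> C * (2 * e)" if e: "0 < e" for e
  proof -
    obtain P where P: "real_polynomial_function P" "\<And>z. z \<in> sphere 0 1 \<Longrightarrow> \<bar>Re (\<phi> z) - P z\<bar> < e"
      by (rule Stone_Weierstrass_real_polynomial_function[OF compact_sphere continuous_on_Re[OF \<phi>] e]) blast
    obtain Q where Q: "real_polynomial_function Q" "\<And>z. z \<in> sphere 0 1 \<Longrightarrow> \<bar>Im (\<phi> z) - Q z\<bar> < e"
      by (rule Stone_Weierstrass_real_polynomial_function[OF compact_sphere continuous_on_Im[OF \<phi>] e]) blast
    let ?p = "\<lambda>x. D x * of_real (P (cis (2 * pi * x)))"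
    let ?q = "\<lambda>x. D x * of_real (Q (cis (2 * pi * x)))"
    have p: "continuous_on {0..1} ?p" "integral {0..1} ?p = 0"
      using vanishing_coefficients_times_polynomial[OF P(1) vanish]
      by (auto simp: vanishing_coefficients_def dest: spec[of _ 0])
    have q: "continuous_on {0..1} ?q" "integral {0..1} ?q = 0"
      using vanishing_coefficients_times_polynomial[OF Q(1) vanish]
      by (auto simp: vanishing_coefficients_def dest: spec[of _ 0])
    have DD: "continuous_on {0..1} (\<lambda>x. D x * cnj (D x))"
      by (intro continuous_intros D01)
    have "(\<lambda>x. D x * cnj (D x) - (?p x - \<i> * ?q x)) = (\<lambda>x. D x * (cnj (D x)
        - (of_real (P (cis (2 * pi * x))) - \<i> * of_real (Q (cis (2 * pi * x))))))"
      by (simp add: algebra_simps)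
    have "integral {0..1} (\<lambda>x. D x * cnj (D x)) = integral {0..1} (\<lambda>x. D x * cnj (D x) - (?p x - \<i> * ?q x))"
      using p q DD by (simp add: integral_diff integrable_continuous_real integrable_diff continuous_on_mult_left)
    also have "norm \<dots> \<le> (C * (2 * e)) * (1 - 0)"
    proof (rule integral_bound)
      show "continuous_on {0..1} (\<lambda>x. D x * cnj (D x) - (?p x - \<i> * ?q x))"
        by (intro continuous_on_diff DD p q continuous_on_mult_left)
      fix x :: real assume x: "x \<in> {0..1}"
      let ?z = "cis (2 * pi * x)"
      let ?w = "cnj (D x) - (of_real (P ?z) - \<i> * of_real (Q ?z))"
      have "norm ?w \<le> \<bar>Re ?w\<bar> + \<bar>Im ?w\<bar>" by (rule cmod_le)
      also have "\<dots> \<le> 2 * e"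
        using P(2)[of ?z] Q(2)[of ?z] by (simp add: \<phi>_cis)
      finally have "norm (D x) * norm ?w \<le> C * (2 * e)"
        using C[OF x] \<open>0 \<le> C\<close> by (intro mult_mono) auto
      also have "norm (D x) * norm ?w = norm (D x * cnj (D x) - (?p x - \<i> * ?q x))"
        by (simp add: norm_mult[symmetric] algebra_simps)
      finally show "norm (D x * cnj (D x) - (?p x - \<i> * ?q x)) \<le> C * (2 * e)" .
    qed simp
    finally show ?thesis by simp
  qed
  have "norm (integral {0..1} (\<lambda>x. D x * cnj (D x))) \<le> 0"
  proof (rule field_le_epsilon)
    fix e :: real assume "0 < e"
    have "C * (2 * (e / (2 * (C + 1)))) \<le> e"
      using \<open>0 \<le> C\<close> \<open>0 < e\<close> by (simp add: field_simps)
    with small[of "e / (2 * (C + 1))"] \<open>0 \<le> C\<close> \<open>0 < e\<close>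
    show "norm (integral {0..1} (\<lambda>x. D x * cnj (D x))) \<le> 0 + e" by simp
  qed
  moreover have "integral {0..1} (\<lambda>x. D x * cnj (D x)) = of_real (integral {0..1} (\<lambda>x. (norm (D x))\<^sup>2))"
  proof -
    have "(\<lambda>x. D x * cnj (D x)) = (\<lambda>x. of_real ((norm (D x))\<^sup>2))"
      by (simp only: complex_norm_square)
    moreover have "(\<lambda>x. (norm (D x))\<^sup>2) integrable_on {0..1}"
      by (intro integrable_continuous_real continuous_intros D01)
    ultimately show ?thesis
      using integral_linear[OF _ bounded_linear_of_real, of "\<lambda>x. (norm (D x))\<^sup>2" "{0..1}"] by (simp add: o_def)
  qed
  ultimately have "integral {0..1} (\<lambda>x. (norm (D x))\<^sup>2) = 0" by simp
  moreover have "continuous_on {0..1} (\<lambda>x. (norm (D x))\<^sup>2)"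
    by (intro continuous_intros D01)
  ultimately have "\<forall>y\<in>{0..1}. (norm (D y))\<^sup>2 = 0"
    by (subst (asm) integral_eq_0_iff) simp_all
  then have zero: "D y = 0" if "y \<in> {0..1}" for y
    using that by simp
  have "frac x + of_int \<lfloor>x\<rfloor> = x" by (simp add: frac_def)
  then have "D x = D (frac x)"
    using per[of "frac x" "\<lfloor>x\<rfloor>"] by (simp only:)
  moreover have "frac x \<in> {0..1}"
    by (simp add: frac_lt_1 less_imp_le)
  ultimately show ?thesis using zero by (simp only:)
qed

section \<open>Poisson summation\<close>

lemma has_sum_integral_uniform:
  fixes c :: "int \<Rightarrow> real \<Rightarrow> complex" and M :: "int \<Rightarrow> real"
  assumes cont: "\<And>k. continuous_on {a..b} (c k)"
    and bound: "\<And>k x. x \<in> {a..b} \<Longrightarrow> norm (c k x) \<le> M k" and M: "M summable_on UNIV"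
  shows "((\<lambda>k. integral {a..b} (c k)) has_sum integral {a..b} (\<lambda>x. \<Sum>\<^sub>\<infinity>k. c k x)) UNIV"
proof -
  have lim: "uniform_limit {a..b} (\<lambda>X x. \<Sum>k\<in>X. c k x) (\<lambda>x. \<Sum>\<^sub>\<infinity>k. c k x) (finite_subsets_at_top UNIV)"
    by (intro Weierstrass_m_test_general[OF _ M] bound)
  obtain I J where I: "\<And>X. ((\<lambda>x. \<Sum>k\<in>X. c k x) has_integral I X) {a..b}"
    and J: "((\<lambda>x. \<Sum>\<^sub>\<infinity>k. c k x) has_integral J) {a..b}" and IJ: "(I \<longlongrightarrow> J) (finite_subsets_at_top UNIV)"
    by (rule uniform_limit_integral[OF lim]) (auto intro!: continuous_on_sum cont)
  have "I X = (\<Sum>k\<in>X. integral {a..b} (c k))" if "finite X" for X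
    using integral_unique[OF I[of X]] integral_sum[OF that, of c "{a..b}"] cont
    by (simp add: integrable_continuous_real)
  then have "eventually (\<lambda>X. I X = (\<Sum>k\<in>X. integral {a..b} (c k))) (finite_subsets_at_top UNIV)"
    by (auto intro: eventually_finite_subsets_at_top_weakI)
  with IJ show ?thesis
    using integral_unique[OF J] unfolding has_sum_def by (auto elim: Lim_transform_eventually)
qed

lemma locally_uniformly_summable_summable:
  assumes "locally_uniformly_summable f"
  shows "(\<lambda>k. f (x + of_int k)) summable_on UNIV"
proof -
  obtain B :: "int \<Rightarrow> real" where B: "B summable_on UNIV" "\<And>k y. \<bar>y\<bar> \<le> \<bar>x\<bar> \<Longrightarrow> norm (f (y + of_int k)) \<le> B k"
    using assms unfolding locally_uniformly_summable_def by blast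
  have "(\<lambda>k. norm (f (x + of_int k))) summable_on UNIV"
    by (rule Infinite_Sum.abs_summable_on_comparison_test'[OF B(1)]) (use B(2) in auto)
  then show ?thesis by (rule abs_summable_summable)
qed

lemma continuous_on_periodization:
  assumes f: "continuous_on UNIV f" and sum: "locally_uniformly_summable f"
  shows "continuous_on UNIV (\<lambda>x. \<Sum>\<^sub>\<infinity>k::int. f (x + of_int k))"
proof -
  have cont: "continuous_on {- R<..<R} (\<lambda>x. \<Sum>\<^sub>\<infinity>k::int. f (x + of_int k))" for R
  proof -
    obtain B :: "int \<Rightarrow> real" where B: "B summable_on UNIV" "\<And>k y. \<bar>y\<bar> \<le> R \<Longrightarrow> norm (f (y + of_int k)) \<le> B k"
      using sum unfolding locally_uniformly_summable_def by blast
    have "uniform_limit {- R<..<R} (\<lambda>X x. \<Sum>k\<in>X. f (x + of_int k)) (\<lambda>x. \<Sum>\<^sub>\<infinity>k. f (x + of_int k)) (finite_subsets_at_top UNIV)"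
      by (intro Weierstrass_m_test_general[OF _ B(1)] B(2)) auto
    moreover have "continuous_on {- R<..<R} (\<lambda>x. \<Sum>k\<in>X. f (x + of_int k))" for X
      by (intro continuous_on_sum continuous_on_compose2[OF f] continuous_intros) auto
    ultimately show ?thesis
      by (intro uniform_limit_theorem) auto
  qed
  have "isCont (\<lambda>x. \<Sum>\<^sub>\<infinity>k::int. f (x + of_int k)) x" for x
  proof -
    have "x \<in> {- (\<bar>x\<bar> + 1)<..<\<bar>x\<bar> + 1}" by auto
    then show ?thesis
      using cont[of "\<bar>x\<bar> + 1"] continuous_on_eq_continuous_at[OF open_greaterThanLessThan] by blast
  qed
  then show ?thesis by (simp add: continuous_at_imp_continuous_on)
qed

lemma periodization_periodic:
  "(\<Sum>\<^sub>\<infinity>k::int. f (x + of_int m + of_int k)) = (\<Sum>\<^sub>\<infinity>k::int. f (x + of_int k :: real) :: complex)"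
proof -
  have "bij (\<lambda>k::int. m + k)"
    by (rule bij_betw_byWitness[where f' = "\<lambda>k. k - m"]) auto
  from infsum_reindex_bij_betw[OF this, of "\<lambda>k. f (x + of_int k)"]
  show ?thesis by (simp add: add.assoc)
qed

lemma locally_uniformly_summable_imp_integrable:
  assumes f: "continuous_on UNIV f" and sum: "locally_uniformly_summable f"
  shows "integrable lborel f"
proof -
  obtain B :: "int \<Rightarrow> real" where B: "B summable_on UNIV" "\<And>k y. \<bar>y\<bar> \<le> 1 \<Longrightarrow> norm (f (y + of_int k)) \<le> B k"
    using sum unfolding locally_uniformly_summable_def by blast
  show ?thesis
  proof (rule integrable_if_floor_bound)
    show "f \<in> borel_measurable lborel"
      using borel_measurable_continuous_onI[OF f] by simp
    show "0 \<le> B k" for k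
      using order_trans[OF norm_ge_zero B(2)[of 0 k]] by simp
    have "norm (f x) \<le> B \<lfloor>x\<rfloor>" for x
      using B(2)[of "frac x" "\<lfloor>x\<rfloor>"] by (simp add: frac_def) linarith
    then show "AE x in lborel. norm (f x) \<le> B \<lfloor>x\<rfloor>" by simp
  qed fact
qed

text \<open>
  Integrating a periodization over a period is integrating the function over the line, which is
  cut into its unit cells.
\<close>

lemma integral_unfold:
  fixes q :: "real \<Rightarrow> complex"
  assumes int: "integrable lborel q" and cont: "continuous_on UNIV q"
    and sum: "((\<lambda>k::int. integral {0..1} (\<lambda>x. q (x + of_int k))) has_sum S) UNIV"
  shows "S = (LINT x|lborel. q x)"
proof -
  have piece: "(LINT x:unit_cell n|lborel. q x) = integral {0..1} (\<lambda>x. q (x + of_int (int_decode n)))" for n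
  proof -
    let ?k = "real_of_int (int_decode n)"
    have "(LINT x:unit_cell n|lborel. q x) = (LINT x:{?k..?k + 1}|lborel. q x)"
      unfolding set_lebesgue_integral_def
    proof (rule integral_cong_AE)
      have [measurable]: "q \<in> borel_measurable borel"
        using int by auto
      show "(\<lambda>x. indicator (unit_cell n) x *\<^sub>R q x) \<in> borel_measurable lborel"
        "(\<lambda>x. indicator {?k..?k + 1} x *\<^sub>R q x) \<in> borel_measurable lborel"
        unfolding unit_cell_def by measurable
      show "AE x in lborel. indicator (unit_cell n) x *\<^sub>R q x = indicator {?k..?k + 1} x *\<^sub>R q x"
        using AE_lborel_singleton[of "?k + 1"] by eventually_elim (auto simp: unit_cell_def indicator_def)
    qed
    also have "\<dots> = integral {?k..?k + 1} q"
      by (intro set_borel_integral_eq_integral(2) borel_integrable_atLeastAtMost' continuous_on_subset[OF cont]) auto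
    also have "\<dots> = integral {0..1} (\<lambda>x. q (x + ?k))"
      using integral_shift_Icc_real[of 0 1 q ?k] by (simp add: o_def add.commute)
    finally show ?thesis .
  qed
  have "((\<lambda>n. integral {0..1} (\<lambda>x. q (x + of_int (int_decode n)))) has_sum S) UNIV"
    using sum has_sum_reindex_bij_betw[OF bij_int_decode, of "\<lambda>k. integral {0..1} (\<lambda>x. q (x + of_int k))" S]
    by simp
  then have "(\<lambda>n. LINT x:unit_cell n|lborel. q x) sums S"
    unfolding piece by (rule has_sum_imp_sums)
  moreover have "(LINT x:(\<Union>n. unit_cell n)|lborel. q x) = (\<Sum>n. LINT x:unit_cell n|lborel. q x)"
  proof (rule lebesgue_integral_countable_add)
    show "unit_cell n \<in> sets lborel" for n by (simp add: unit_cell_def)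
    show "set_integrable lborel (\<Union>n. unit_cell n) q"
      using int unfolding UN_unit_cell set_integrable_def by simp
  qed (use disjoint_unit_cell in \<open>auto simp: disjoint_family_on_def\<close>)
  moreover have "(LINT x:(\<Union>n. unit_cell n)|lborel. q x) = (LINT x|lborel. q x)"
    unfolding UN_unit_cell set_lebesgue_integral_def by simp
  ultimately show ?thesis by (simp add: sums_iff)
qed

lemma cis_of_int_periodic: "cis (2 * pi * of_int n * (x + of_int k)) = cis (2 * pi * of_int n * x)"
proof -
  have "cis (2 * pi * of_int n * (x + of_int k)) = cis (2 * pi * of_int n * x) * cis (2 * pi * of_int (n * k))"
    by (simp add: cis_mult algebra_simps)
  then show ?thesis by (simp add: cis_multiple_2pi)
qed

lemma integral_character:
  "integral {0..1} (\<lambda>x. cis (2 * pi * of_int n * x)) = (if n = 0 then 1 else 0)"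
proof (cases "n = 0")
  case False
  let ?e = "\<lambda>x. cis (2 * pi * of_int n * x)"
  have "(?e has_integral ?e 1 / (2 * pi * \<i> * of_int n) - ?e 0 / (2 * pi * \<i> * of_int n)) {0..1}"
  proof (rule fundamental_theorem_of_calculus)
    fix x :: real assume "x \<in> {0..1}"
    show "((\<lambda>x. ?e x / (2 * pi * \<i> * of_int n)) has_vector_derivative ?e x) (at x within {0..1})"
      using \<open>n \<noteq> 0\<close> unfolding has_vector_derivative_def
      by (auto intro!: derivative_eq_intros simp: scaleR_conv_of_real field_simps)
  qed simp
  moreover have "?e 1 = ?e 0"
    using cis_of_int_periodic[of n 0 1] by simp
  ultimately show ?thesis using False by (simp add: integral_unique)
qed (simp)

lemma fourier_coefficient_periodization:
  assumes f: "continuous_on UNIV f" and sum: "locally_uniformly_summable f"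
  shows "integral {0..1} (\<lambda>x. (\<Sum>\<^sub>\<infinity>k::int. f (x + of_int k)) * cis (2 * pi * of_int n * x)) = fourier f (- of_int n)"
proof -
  obtain B :: "int \<Rightarrow> real" where B: "B summable_on UNIV" "\<And>k y. \<bar>y\<bar> \<le> 1 \<Longrightarrow> norm (f (y + of_int k)) \<le> B k"
    using sum unfolding locally_uniformly_summable_def by blast
  let ?q = "\<lambda>x. f x * cis (2 * pi * of_int n * x)"
  have q: "?q (x + of_int k) = f (x + of_int k) * cis (2 * pi * of_int n * x)" for x and k :: int
    by (simp only: cis_of_int_periodic)
  have "((\<lambda>k. integral {0..1} (\<lambda>x. ?q (x + of_int k))) has_sum
      integral {0..1} (\<lambda>x. \<Sum>\<^sub>\<infinity>k::int. ?q (x + of_int k))) UNIV"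
    unfolding q
    by (rule has_sum_integral_uniform[OF _ _ B(1)])
      (auto simp: norm_mult intro!: B(2) continuous_intros continuous_on_compose2[OF f])
  then have "integral {0..1} (\<lambda>x. \<Sum>\<^sub>\<infinity>k::int. ?q (x + of_int k)) = (LINT x|lborel. ?q x)"
    by (intro integral_unfold integrable_mult_cis locally_uniformly_summable_imp_integrable f sum
        continuous_intros)
  moreover have "(\<Sum>\<^sub>\<infinity>k::int. ?q (x + of_int k)) = (\<Sum>\<^sub>\<infinity>k::int. f (x + of_int k)) * cis (2 * pi * of_int n * x)" for x
    unfolding q by (rule infsum_cmult_left) (rule locally_uniformly_summable_summable[OF sum])
  ultimately show ?thesis
    by (simp add: fourier_cis)
qed

text \<open>
  Both sides are continuous and periodic with period 1. The \<open>n\<close>-th coefficient of the left side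
  is \<open>fourier f n\<close> by unfolding, and that of the right side by integrating the uniformly
  convergent series term by term, so uniqueness of Fourier coefficients applies.
\<close>

theorem poisson_summation:
  assumes f: "continuous_on UNIV f" and sum: "locally_uniformly_summable f"
    and coeff: "(\<lambda>n::int. norm (fourier f (of_int n))) summable_on UNIV"
  shows "(\<Sum>\<^sub>\<infinity>k::int. f (x + of_int k)) = (\<Sum>\<^sub>\<infinity>n::int. fourier f (of_int n) * cis (2 * pi * of_int n * x))"
proof -
  define F where "F x = (\<Sum>\<^sub>\<infinity>k::int. f (x + of_int k))" for x
  define c where "c n x = fourier f (of_int n) * cis (2 * pi * of_int n * x)" for n :: int and x
  define G where "G x = (\<Sum>\<^sub>\<infinity>n. c n x)" for x
  have c_cont: "continuous_on S (c n)" for n S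
    unfolding c_def by (intro continuous_intros)
  have c_norm: "norm (c n x) = norm (fourier f (of_int n))" for n x
    by (simp add: c_def norm_mult)
  have c_summable: "(\<lambda>n. c n x) summable_on UNIV" for x
    by (rule abs_summable_summable) (simp add: c_norm coeff)
  have F_cont: "continuous_on UNIV F"
    unfolding F_def by (rule continuous_on_periodization[OF f sum])
  have G_cont: "continuous_on UNIV G"
  proof (rule uniform_limit_theorem)
    show "uniform_limit UNIV (\<lambda>X x. \<Sum>n\<in>X. c n x) G (finite_subsets_at_top UNIV)"
      unfolding G_def by (rule Weierstrass_m_test_general[OF _ coeff]) (simp add: c_norm)
  qed (auto intro!: continuous_on_sum c_cont)
  have G_coeff: "integral {0..1} (\<lambda>x. G x * cis (2 * pi * of_int m * x)) = fourier f (- of_int m)" for m :: int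
  proof -
    let ?d = "\<lambda>n x. c n x * cis (2 * pi * of_int m * x)"
    have d: "integral {0..1} (?d n) = (if n = - m then fourier f (- of_int m) else 0)" for n
    proof -
      have "?d n = (\<lambda>x. fourier f (of_int n) * cis (2 * pi * of_int (n + m) * x))"
        by (simp add: c_def fun_eq_iff cis_mult algebra_simps)
      then have "integral {0..1} (?d n) = fourier f (of_int n) * (if n + m = 0 then 1 else 0)"
        by (simp only: integral_mult_right integral_character)
      then show ?thesis by (auto simp: add_eq_0_iff2)
    qed
    have "((\<lambda>n. integral {0..1} (?d n)) has_sum integral {0..1} (\<lambda>x. \<Sum>\<^sub>\<infinity>n. ?d n x)) UNIV"
      by (rule has_sum_integral_uniform[OF _ _ coeff])
        (auto simp: norm_mult c_norm intro!: continuous_intros c_cont)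
    moreover have "((\<lambda>n. integral {0..1} (?d n)) has_sum fourier f (- of_int m)) UNIV"
      unfolding d by (rule has_sum_finite_neutralI[of "{- m}"]) auto
    ultimately have "integral {0..1} (\<lambda>x. \<Sum>\<^sub>\<infinity>n. ?d n x) = fourier f (- of_int m)"
      using has_sum_unique by blast
    moreover have "(\<Sum>\<^sub>\<infinity>n. ?d n x) = G x * cis (2 * pi * of_int m * x)" for x
      unfolding G_def by (rule infsum_cmult_left) (rule c_summable)
    ultimately show ?thesis by simp
  qed
  have "F x - G x = 0"
  proof (rule periodic_eq_0_if_vanishing_coefficients)
    show "continuous_on UNIV (\<lambda>x. F x - G x)"
      by (intro continuous_intros F_cont G_cont)
    show "F (x + of_int m) - G (x + of_int m) = F x - G x" for x and m :: int
      by (simp only: F_def G_def c_def periodization_periodic cis_of_int_periodic)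
    fix n :: int
    have "(\<lambda>x. F x * cis (2 * pi * of_int n * x)) integrable_on {0..1}"
      "(\<lambda>x. G x * cis (2 * pi * of_int n * x)) integrable_on {0..1}"
      by (intro integrable_continuous_real continuous_intros continuous_on_subset[OF F_cont] continuous_on_subset[OF G_cont]; simp)+
    then show "integral {0..1} (\<lambda>x. (F x - G x) * cis (2 * pi * of_int n * x)) = 0"
      using fourier_coefficient_periodization[OF f sum, of n] G_coeff[of n]
      by (simp add: left_diff_distrib integral_diff flip: F_def)
  qed
  then show ?thesis by (simp add: F_def G_def c_def)
qed

section \<open>Parity of eigenfunctions\<close>

lemma fourier_dilation:
  assumes "0 < a"
  shows "fourier (\<lambda>x. h (a * x)) \<gamma> = fourier h (\<gamma> / a) / a"
proof -
  have "fourier h (\<gamma> / a) = \<bar>a\<bar> *\<^sub>R (LINT x|lborel. h (0 + a * x) * cis (- (2 * pi * (\<gamma> / a) * (0 + a * x))))"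
    unfolding fourier_cis using assms by (intro lborel_integral_real_affine) simp
  also have "\<dots> = of_real a * fourier (\<lambda>x. h (a * x)) \<gamma>"
    using assms by (simp add: fourier_cis scaleR_conv_of_real mult.assoc)
  finally show ?thesis using assms by simp
qed

lemma fourier_reflect: "fourier (\<lambda>x. h (- x)) \<gamma> = fourier h (- \<gamma>)"
proof -
  have "fourier h (- \<gamma>) = \<bar>- 1\<bar> *\<^sub>R (LINT x|lborel. h (0 + (- 1) * x) * cis (- (2 * pi * (- \<gamma>) * (0 + (- 1) * x))))"
    unfolding fourier_cis by (intro lborel_integral_real_affine) simp
  then show ?thesis by (simp add: fourier_cis)
qed

lemma fourier_cnj: "fourier (\<lambda>x. cnj (w x)) \<gamma> = cnj (fourier w (- \<gamma>))"
proof -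
  have "cnj (fourier w (- \<gamma>)) = (LINT x|lborel. cnj (w x * cis (- (2 * pi * (- \<gamma>) * x))))"
    unfolding fourier_cis by (rule Bochner_Integration.integral_cnj[symmetric])
  then show ?thesis by (simp add: fourier_cis cis_cnj)
qed

text \<open>
  For even \<open>w\<close>, duality evaluates the inner product of \<open>fourier w\<close> and \<open>w\<close> as both \<open>c\<close> and \<open>cnj c\<close>
  times the squared norm \<open>N\<close> of \<open>w\<close>. As \<open>c\<close> is not real, \<open>N = 0\<close>.
\<close>

lemma even_imaginary_eigenfunction_eq_0:
  fixes w :: "real \<Rightarrow> complex"
  assumes w: "continuous_on UNIV w" "integrable lborel w"
    and even: "\<And>x. w (- x) = w x"
    and eigen: "\<And>\<gamma>. fourier w \<gamma> = c * w \<gamma>" and c: "Re c = 0" "c \<noteq> 0"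
  shows "w x = 0"
proof -
  define N where "N = (LINT x|lborel. (norm (w x))\<^sup>2)"
  have nsq: "w x * cnj (w x) = of_real ((norm (w x))\<^sup>2)" for x
    by (simp only: complex_norm_square)
  have "(LINT x|lborel. fourier w x * cnj (w x)) = (LINT x|lborel. w x * fourier (\<lambda>x. cnj (w x)) x)"
    by (intro fourier_duality w) (use w in simp)
  moreover have "fourier w x * cnj (w x) = c * of_real ((norm (w x))\<^sup>2)" for x
    by (simp only: eigen mult.assoc nsq)
  moreover have "w x * fourier (\<lambda>x. cnj (w x)) x = cnj c * of_real ((norm (w x))\<^sup>2)" for x
    by (simp add: fourier_cnj eigen even nsq mult.left_commute[of "w x"])
  moreover have "(LINT x|lborel. d * of_real ((norm (w x))\<^sup>2)) = d * of_real N" for d :: complex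
    by (simp only: integral_mult_right_zero integral_complex_of_real N_def)
  ultimately have "c * of_real N = cnj c * of_real N"
    by (simp only:)
  then have "N = 0"
    using c by (auto simp: complex_eq_iff)
  \<comment> \<open>The eigenfunction equation bounds \<open>w\<close>, so the integral \<open>N\<close> is a genuine one and not the default value 0.\<close>
  obtain C where C: "norm (w x) \<le> C" for x
  proof
    fix x
    have "norm c * norm (w x) = norm (LINT y|lborel. w y * cis (- (2 * pi * x * y)))"
      by (simp add: eigen[symmetric] fourier_cis flip: norm_mult)
    also have "\<dots> \<le> (LINT y|lborel. norm (w y * cis (- (2 * pi * x * y))))"
      by (rule integral_norm_bound)
    also have "\<dots> = (LINT y|lborel. norm (w y))"
      by (simp add: norm_mult)
    finally show "norm (w x) \<le> (LINT y|lborel. norm (w y)) / norm c"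
      using c by (simp add: field_simps)
  qed
  have "integrable lborel (\<lambda>x. (norm (w x))\<^sup>2)"
  proof (rule Bochner_Integration.integrable_bound)
    show "integrable lborel (\<lambda>x. C * norm (w x))" using w by simp
    show "AE x in lborel. norm ((norm (w x))\<^sup>2) \<le> norm (C * norm (w x))"
    proof (rule AE_I2)
      fix x
      have "norm (w x) * norm (w x) \<le> C * norm (w x)"
        by (intro mult_right_mono C) simp
      then show "norm ((norm (w x))\<^sup>2) \<le> norm (C * norm (w x))"
        by (simp add: power2_eq_square)
    qed
    show "(\<lambda>x. (norm (w x))\<^sup>2) \<in> borel_measurable lborel"
      using w(2) by measurable
  qed
  then have "AE x in lborel. (norm (w x))\<^sup>2 = 0"
    using \<open>N = 0\<close> unfolding N_def by (subst (asm) integral_nonneg_eq_0_iff_AE) auto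
  then have "w = (\<lambda>x. 0)"
    by (intro continuous_AE_eq_imp_eq w continuous_on_const) simp
  then show ?thesis by simp
qed

text \<open>
  The even part of an eigenfunction is an eigenfunction for the same eigenvalue.
\<close>

lemma imaginary_eigenfunction_odd:
  assumes h: "continuous_on UNIV h" "integrable lborel h"
    and eigen: "\<And>\<gamma>. fourier h \<gamma> = c * h \<gamma>" and c: "Re c = 0" "c \<noteq> 0"
  shows "h (- x) = - h x"
proof -
  have int: "integrable lborel (\<lambda>x. h (- x))"
    using lborel_integrable_real_affine[OF h(2), of "- 1" 0] by simp
  have "h x + h (- x) = 0"
  proof (rule even_imaginary_eigenfunction_eq_0[where c = c and w = "\<lambda>x. h x + h (- x)"])
    show "continuous_on UNIV (\<lambda>x. h x + h (- x))"
      by (intro continuous_intros h continuous_on_compose2[OF h(1)]) auto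
    fix \<gamma>
    have "fourier (\<lambda>x. h x + h (- x)) \<gamma> = fourier h \<gamma> + fourier (\<lambda>x. h (- x)) \<gamma>"
      using integrable_mult_cis[OF h(2), of "- (2 * pi * \<gamma>)"] integrable_mult_cis[OF int, of "- (2 * pi * \<gamma>)"]
      unfolding fourier_cis by (simp add: distrib_right)
    then show "fourier (\<lambda>x. h x + h (- x)) \<gamma> = c * (h \<gamma> + h (- \<gamma>))"
      by (simp add: fourier_reflect eigen distrib_left)
  qed (use h int c in auto)
  then show ?thesis by (simp add: add_eq_0_iff)
qed

text \<open>
  The representative is \<open>fourier g\<close> divided by the eigenvalue; changing \<open>g\<close> on a null set does
  not change its Fourier integral, so the eigenfunction equation holds at every point.
\<close>

lemma eigenspace_continuous_rep:
  assumes "g \<in> fourier_eigenspace l" "g \<in> wiener_space"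
  shows "continuous_on UNIV (continuous_rep g)"
    and "AE x in lborel. continuous_rep g x = g x"
    and "fourier (continuous_rep g) \<gamma> = (- \<i>) ^ l * continuous_rep g \<gamma>"
proof -
  let ?P = "\<lambda>h. continuous_on UNIV h \<and> (AE x in lborel. h x = g x)"
  obtain b :: "int \<Rightarrow> real" where b: "\<And>k. 0 \<le> b k" "b summable_on UNIV"
    "AE x in lborel. norm (g x) \<le> b \<lfloor>x\<rfloor>"
    using wiener_space_floor_bound[OF assms(2)] by blast
  have g_meas: "g \<in> borel_measurable lborel"
    using assms(2) by (simp add: wiener_space_def)
  have g_int: "integrable lborel g"
    by (rule integrable_if_floor_bound[OF g_meas b])
  have eps: "(- \<i>) ^ l \<noteq> 0" by simp
  have ae: "AE x in lborel. (- \<i>) ^ l * g x = fourier g x"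
    using assms(1) by (intro L2_fourier_eq_fourier_AE g_int) (simp add: fourier_eigenspace_def)
  define h where "h x = fourier g x / (- \<i>) ^ l" for x
  have h: "?P h"
  proof
    show "continuous_on UNIV h"
      unfolding h_def by (intro continuous_intros continuous_on_fourier g_int) simp
    show "AE x in lborel. h x = g x"
      using ae by eventually_elim (use eps in \<open>simp add: h_def field_simps\<close>)
  qed
  have unique: "h' = h" if "?P h'" for h'
  proof (rule continuous_AE_eq_imp_eq)
    from that h have "AE x in lborel. h' x = g x" "AE x in lborel. h x = g x" by auto
    then show "AE x in lborel. h' x = h x" by eventually_elim simp
  qed (use that h in auto)
  have rep: "continuous_rep g = h"
    unfolding continuous_rep_def by (rule the_equality[where P = ?P, OF h unique])
  show "continuous_on UNIV (continuous_rep g)" "AE x in lborel. continuous_rep g x = g x"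
    using h by (simp_all add: rep)
  have "fourier h \<gamma> = fourier g \<gamma>"
    unfolding fourier_cis
  proof (rule integral_cong_AE)
    have [measurable]: "h \<in> borel_measurable borel"
      using h by (intro borel_measurable_continuous_onI) simp
    note [measurable] = g_meas
    show "(\<lambda>x. h x * cis (- (2 * pi * \<gamma> * x))) \<in> borel_measurable lborel"
      "(\<lambda>x. g x * cis (- (2 * pi * \<gamma> * x))) \<in> borel_measurable lborel"
      unfolding cis_conv_exp by measurable
    from h have "AE x in lborel. h x = g x" by simp
    then show "AE x in lborel. h x * cis (- (2 * pi * \<gamma> * x)) = g x * cis (- (2 * pi * \<gamma> * x))"
      by eventually_elim simp
  qed
  then show "fourier (continuous_rep g) \<gamma> = (- \<i>) ^ l * continuous_rep g \<gamma>"
    by (simp add: rep h_def)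
qed


section \<open>Samples of the Zak transform on a finite cyclic group\<close>

text \<open>
  The Zak transform at the point \<open>(r / N, 0)\<close> without its normalizing factor. An integer \<open>r\<close> lets
  \<open>lattice_sum h a r N\<close> be read as a function of \<open>r\<close> on the cyclic group of order \<open>N\<close>.
\<close>

definition lattice_sum :: "(real \<Rightarrow> complex) \<Rightarrow> real \<Rightarrow> int \<Rightarrow> nat \<Rightarrow> complex" where
  "lattice_sum h a r N = (\<Sum>\<^sub>\<infinity>k::int. h (a * (of_int r / of_nat N + of_int k)))"

lemma zak_eq_lattice_sum: "zak a h (of_nat p / of_nat N) 0 = sqrt a * lattice_sum h a (int p) N"
  by (simp add: zak_def lattice_sum_def)

lemma lattice_sum_periodic:
  assumes "0 < N"
  shows "lattice_sum h a (r + of_nat N * m) N = lattice_sum h a r N"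
proof -
  have "of_int (r + of_nat N * m) / of_nat N = of_int r / of_nat N + real_of_int m"
    using assms by (simp add: field_simps)
  then show ?thesis
    unfolding lattice_sum_def using periodization_periodic[of "\<lambda>x. h (a * x)"] by simp
qed

lemma lattice_sum_odd:
  assumes "\<And>x. h (- x) = - h x"
  shows "lattice_sum h a (- r) N = - lattice_sum h a r N"
proof -
  have "bij (uminus :: int \<Rightarrow> int)" by (rule bij_uminus)
  then have "lattice_sum h a (- r) N = (\<Sum>\<^sub>\<infinity>k::int. h (a * (of_int (- r) / of_nat N + of_int (- k))))"
    unfolding lattice_sum_def
    by (rule infsum_reindex_bij_betw[symmetric])
  also have "\<dots> = (\<Sum>\<^sub>\<infinity>k::int. - h (a * (of_int r / of_nat N + of_int k)))"
    by (simp add: algebra_simps flip: assms)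
  finally show ?thesis by (simp add: infsum_uminus lattice_sum_def)
qed

lemma infsum_residue_classes:
  fixes f :: "int \<Rightarrow> complex"
  assumes "0 < N" and f: "f summable_on UNIV"
  shows "(\<Sum>\<^sub>\<infinity>n. f n) = (\<Sum>r<N. \<Sum>\<^sub>\<infinity>k::int. f (int N * k + int r))"
proof -
  have UN: "(\<Union>r\<in>{..<N}. range (\<lambda>k. int N * k + int r)) = UNIV"
  proof (intro set_eqI iffI UNIV_I)
    fix n :: int
    have "n = int N * (n div int N) + int (nat (n mod int N))" "nat (n mod int N) < N"
      using assms(1) by (auto simp: nat_less_iff)
    then show "n \<in> (\<Union>r\<in>{..<N}. range (\<lambda>k. int N * k + int r))" by blast
  qed
  have disj: "range (\<lambda>k. int N * k + int r) \<inter> range (\<lambda>k. int N * k + int r') = {}"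
    if "r \<in> {..<N}" "r' \<in> {..<N}" "r \<noteq> r'" for r r'
  proof -
    have "int N * k + int r \<noteq> int N * k' + int r'" for k k'
    proof
      assume "int N * k + int r = int N * k' + int r'"
      then have "(int N * k + int r) mod int N = (int N * k' + int r') mod int N"
        by (rule arg_cong)
      with that show False by simp
    qed
    then show ?thesis by auto
  qed
  have "(\<Sum>r<N. \<Sum>\<^sub>\<infinity>n\<in>range (\<lambda>k. int N * k + int r). f n) = (\<Sum>\<^sub>\<infinity>n\<in>(\<Union>r\<in>{..<N}. range (\<lambda>k. int N * k + int r)). f n)"
    by (intro sum_infsum disj summable_on_subset_banach[OF f]) auto
  moreover have "(\<Sum>\<^sub>\<infinity>n\<in>range (\<lambda>k. int N * k + int r). f n) = (\<Sum>\<^sub>\<infinity>k. f (int N * k + int r))" for r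
    using assms(1) by (subst infsum_reindex) (auto simp: inj_on_def o_def)
  ultimately show ?thesis by (simp add: UN)
qed

text \<open>
  Poisson summation for the dilation \<open>h (a x)\<close>, with the dual sum split into the residue classes
  \<open>n = N k + r\<close>. The character depends on \<open>r\<close> only, and \<open>n / a = (N / a) (k + r / N)\<close>.
\<close>

lemma lattice_sum_transform:
  assumes h: "continuous_on UNIV h" and sum: "\<And>a. 0 < a \<Longrightarrow> locally_uniformly_summable (\<lambda>x. h (a * x))"
    and eigen: "\<And>\<gamma>. fourier h \<gamma> = c * h \<gamma>" and N: "0 < N" and "0 < a"
  shows "lattice_sum h a p N = c / a * (\<Sum>r<N. cis (2 * pi * of_int p * r / N) * lattice_sum h (N / a) (int r) N)"
proof -
  let ?f = "\<lambda>x. h (a * x)"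
  have F: "fourier ?f (of_int n) = c / a * h (of_int n / a)" for n :: int
    using fourier_dilation[OF \<open>0 < a\<close>, of h "of_int n"] by (simp add: eigen)
  have f_cont: "continuous_on UNIV ?f"
    by (rule continuous_on_compose2[OF h]) (auto intro!: continuous_intros)
  have "locally_uniformly_summable (\<lambda>x. h (1 / a * x))"
    using \<open>0 < a\<close> by (intro sum) simp
  from locally_uniformly_summable_summable[OF this, of 0]
  have "(\<lambda>n::int. h (of_int n / a)) summable_on UNIV" by simp
  then have norm_sum: "(\<lambda>n::int. norm (h (of_int n / a))) summable_on UNIV"
    by (simp add: summable_on_iff_abs_summable_on_complex)
  have "lattice_sum h a p N = (\<Sum>\<^sub>\<infinity>n::int. fourier ?f (of_int n) * cis (2 * pi * of_int n * (of_int p / N)))"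
    unfolding lattice_sum_def
  proof (rule poisson_summation[OF f_cont sum[OF \<open>0 < a\<close>]])
    show "(\<lambda>n::int. norm (fourier ?f (of_int n))) summable_on UNIV"
      unfolding F norm_mult by (intro summable_on_cmult_right norm_sum)
  qed
  also have "\<dots> = (\<Sum>\<^sub>\<infinity>n::int. c / a * (h (of_int n / a) * cis (2 * pi * of_int n * (of_int p / N))))"
    by (simp only: F mult.assoc)
  also have "\<dots> = c / a * (\<Sum>\<^sub>\<infinity>n::int. h (of_int n / a) * cis (2 * pi * of_int n * (of_int p / N)))"
    by (rule infsum_cmult_right')
  also have "(\<Sum>\<^sub>\<infinity>n::int. h (of_int n / a) * cis (2 * pi * of_int n * (of_int p / N))) =
    (\<Sum>r<N. \<Sum>\<^sub>\<infinity>k::int. h (of_int (int N * k + int r) / a) * cis (2 * pi * of_int (int N * k + int r) * (of_int p / N)))"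
    by (rule infsum_residue_classes[OF N], rule abs_summable_summable) (simp add: norm_mult norm_sum)
  also have "\<dots> = (\<Sum>r<N. cis (2 * pi * of_int p * r / N) * lattice_sum h (N / a) (int r) N)"
  proof (rule sum.cong[OF refl])
    fix r
    have "h (of_int (int N * k + int r) / a) * cis (2 * pi * of_int (int N * k + int r) * (of_int p / N))
        = cis (2 * pi * of_int p * r / N) * h (N / a * (of_int (int r) / N + of_int k))" for k :: int
    proof -
      have "2 * pi * of_int (int N * k + int r) * (of_int p / N) = 2 * pi * of_int p * r / N + 2 * pi * of_int (p * k)"
        using N by (simp add: field_simps)
      then have "cis (2 * pi * of_int (int N * k + int r) * (of_int p / N)) = cis (2 * pi * of_int p * r / N)"
        by (simp only: cis_mult[symmetric]) (simp add: cis_multiple_2pi)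
      moreover have "of_int (int N * k + int r) / a = N / a * (of_int (int r) / N + of_int k)"
        using N \<open>0 < a\<close> by (simp add: field_simps)
      ultimately show ?thesis by (simp only: mult.commute)
    qed
    then show "(\<Sum>\<^sub>\<infinity>k::int. h (of_int (int N * k + int r) / a) * cis (2 * pi * of_int (int N * k + int r) * (of_int p / N)))
        = cis (2 * pi * of_int p * r / N) * lattice_sum h (N / a) (int r) N"
      unfolding lattice_sum_def by (simp only: infsum_cmult_right')
  qed
  finally show ?thesis .
qed

text \<open>
  An odd vector vanishes at every residue \<open>r\<close> with \<open>2 r = 0\<close>, so for \<open>N = 3\<close> and \<open>N = 4\<close> it is
  determined by its value at 1. With \<open>w = cis (2 * pi * p / N)\<close> the transform is
  \<open>(w - w ^ (N - 1)) v 1 = 2 \<i> sin (2 * pi * p / N) v 1\<close>.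
\<close>

lemma fourier_odd_vector_3_4:
  fixes v :: "int \<Rightarrow> complex"
  assumes odd: "\<And>r. v (- r) = - v r" and per: "\<And>r m. v (r + of_nat N * m) = v r"
    and N: "N \<in> {3, 4}" and p: "p < N"
  shows "(\<Sum>r<N. cis (2 * pi * of_int (int p) * r / N) * v (int r)) = \<i> * sqrt N * v (int p)"
proof -
  have v0: "v 0 = 0" using odd[of 0] by simp
  have refl: "v (int N - r) = - v r" for r
    using per[of "- r" 1] odd[of r] by simp
  define w where "w = cis (2 * pi * p / N)"
  have w: "cis (2 * pi * of_int (int p) * r / N) = w ^ r" for r
    by (simp add: w_def Complex.DeMoivre mult_ac)
  from N consider "N = 3" | "N = 4" by auto
  then show ?thesis
  proof cases
    case 1
    have v2: "v 2 = - v 1" using refl[of 1] 1 by simp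
    have sum: "(\<Sum>r<N. w ^ r * v (int r)) = (w - w\<^sup>2) * v 1"
      by (simp add: 1 eval_nat_numeral v0 v2[simplified] algebra_simps)
    from p 1 consider "p = 0" | "p = 1" | "p = 2" by linarith
    then show ?thesis
    proof cases
      case 2
      have w_eq: "w = Complex (- 1 / 2) (sqrt 3 / 2)"
        by (simp add: w_def 1 2 complex_eq_iff cos_120 sin_120)
      have "w - w\<^sup>2 = \<i> * sqrt 3"
        unfolding w_eq by (simp add: complex_eq_iff power2_eq_square)
      then show ?thesis unfolding w sum by (simp add: 1 2)
    next
      case 3
      have "w = cis pi * cis (pi / 3)"
        by (simp add: w_def 1 3 cis_mult field_simps del: cis_pi)
      then have w_eq: "w = Complex (- 1 / 2) (- sqrt 3 / 2)"
        by (simp add: complex_eq_iff cos_60 sin_60)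
      have "w - w\<^sup>2 = - (\<i> * sqrt 3)"
        unfolding w_eq by (simp add: complex_eq_iff power2_eq_square)
      then show ?thesis unfolding w sum by (simp add: 1 3 v2)
    next
      case 1
      have "w = 1" by (simp add: w_def \<open>p = 0\<close>)
      then show ?thesis unfolding w sum by (simp add: \<open>p = 0\<close> v0)
    qed
  next
    case 2
    have v2: "v 2 = 0" and v3: "v 3 = - v 1" using refl[of 2] refl[of 1] 2 by simp_all
    have sum: "(\<Sum>r<N. w ^ r * v (int r)) = (w - w ^ 3) * v 1"
      by (simp add: 2 eval_nat_numeral v0 v2[simplified] v3[simplified] algebra_simps)
    have sqrt4: "sqrt 4 = 2"
      using real_sqrt_abs[of 2] by simp
    from p 2 consider "p = 0" | "p = 1" | "p = 2" | "p = 3" by linarith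
    then show ?thesis
    proof cases
      case 2
      have "w = \<i>" using cis_pi_half by (simp add: w_def \<open>N = 4\<close> 2)
      then show ?thesis unfolding w sum by (simp add: \<open>N = 4\<close> 2 sqrt4 power3_eq_cube)
    next
      case 3
      have "w = - 1" by (simp add: w_def \<open>N = 4\<close> 3)
      then show ?thesis unfolding w sum by (simp add: \<open>N = 4\<close> 3 v2)
    next
      case 4
      have "w = cis pi * cis (pi / 2)"
        by (simp add: w_def \<open>N = 4\<close> 4 cis_mult field_simps del: cis_pi cis_pi_half)
      then have "w = - \<i>" by simp
      then show ?thesis unfolding w sum by (simp add: \<open>N = 4\<close> 4 v3 sqrt4 power3_eq_cube)
    next
      case 1
      have "w = 1" by (simp add: w_def \<open>p = 0\<close>)
      then show ?thesis unfolding w sum by (simp add: \<open>p = 0\<close> v0)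
    qed
  qed
qed

theorem theorem4p7:
  fixes l :: nat and g :: "real \<Rightarrow> complex" and s lam :: real and p :: nat
  assumes "l \<in> {1, 3}"
    and "g \<in> fourier_eigenspace l \<inter> wiener_space"
    and "s > 0" and "s\<^sup>2 \<in> {3, 4}"
    and "lam > 0"
    and "real p \<le> s\<^sup>2 - 1"
  shows "zak (s * lam) (continuous_rep g) (real p / s\<^sup>2) 0 =
    (-1) ^ ((l - 1) div 2) * zak (s / lam) (continuous_rep g) (real p / s\<^sup>2) 0"
proof -
  define h where "h = continuous_rep g"
  define c where "c = (- \<i>) ^ l"
  have c: "Re c = 0" "c \<noteq> 0" "c * \<i> = (- 1) ^ ((l - 1) div 2)"
    using assms(1) by (auto simp: c_def eval_nat_numeral)
  from assms(2) have g: "g \<in> fourier_eigenspace l" "g \<in> wiener_space" by auto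
  have h_cont: "continuous_on UNIV h" and h_AE: "AE x in lborel. h x = g x"
    and eigen: "\<And>\<gamma>. fourier h \<gamma> = c * h \<gamma>"
    unfolding h_def c_def using eigenspace_continuous_rep[OF g] by blast+
  obtain b :: "int \<Rightarrow> real" where b: "\<And>k. 0 \<le> b k" "b summable_on UNIV"
    and bound: "AE x in lborel. norm (g x) \<le> b \<lfloor>x\<rfloor>"
    using wiener_space_floor_bound[OF g(2)] by blast
  have "AE x in lborel. norm (h x) \<le> b \<lfloor>x\<rfloor>"
    using h_AE bound by eventually_elim simp
  from continuous_floor_bound[OF h_cont this] have h_bound: "\<And>x. norm (h x) \<le> b \<lfloor>x\<rfloor>" .
  have sum: "locally_uniformly_summable (\<lambda>x. h (a * x))" if "0 < a" for a
    using locally_uniformly_summable_dilation[OF that b h_bound] .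
  have "integrable lborel h"
    using locally_uniformly_summable_imp_integrable[OF h_cont] sum[of 1] by simp
  then have odd: "h (- x) = - h x" for x
    by (rule imaginary_eigenfunction_odd[OF h_cont _ eigen c(1,2)])
  define N where "N = (if s\<^sup>2 = 3 then 3 else 4 :: nat)"
  have N: "N \<in> {3, 4}" "s\<^sup>2 = real N" "0 < N"
    using assms(4) by (auto simp: N_def)
  have s: "s = sqrt N" using N(2) assms(3) by (metis less_imp_le real_sqrt_unique)
  have p: "p < N" using assms(6) N(2) by simp
  have sl: "0 < s * lam" "real N / (s * lam) = s / lam"
    using assms(3,5) N(2) by (auto simp: power2_eq_square field_simps)
  have "lattice_sum h (s * lam) (int p) N
      = c / (s * lam) * (\<Sum>r<N. cis (2 * pi * of_int (int p) * r / N) * lattice_sum h (s / lam) (int r) N)"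
    using lattice_sum_transform[OF h_cont sum eigen N(3) sl(1), of "int p"] by (simp only: sl(2))
  also have "\<dots> = c / (s * lam) * (\<i> * sqrt N * lattice_sum h (s / lam) (int p) N)"
    by (subst fourier_odd_vector_3_4[where v = "\<lambda>r. lattice_sum h (s / lam) r N"])
      (simp_all only: lattice_sum_odd[where h = h, OF odd] lattice_sum_periodic[OF N(3)] N(1) p)
  also have "\<dots> = (c * \<i>) * lattice_sum h (s / lam) (int p) N / lam"
    using assms(3) by (simp add: s[symmetric])
  finally have main: "lattice_sum h (s * lam) (int p) N = (c * \<i>) * lattice_sum h (s / lam) (int p) N / lam" .
  have "sqrt (s * lam) / lam = sqrt (s / lam)"
    using assms(3,5) by (simp add: real_sqrt_mult real_sqrt_divide field_simps)
  then have scale: "of_real (sqrt (s * lam)) / of_real lam = (of_real (sqrt (s / lam)) :: complex)"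
    by (metis of_real_divide)
  have "zak (s * lam) h (real p / s\<^sup>2) 0 = of_real (sqrt (s * lam)) / of_real lam * ((c * \<i>) * lattice_sum h (s / lam) (int p) N)"
    unfolding N(2) zak_eq_lattice_sum main by simp
  also have "\<dots> = (c * \<i>) * zak (s / lam) h (real p / s\<^sup>2) 0"
    unfolding N(2) zak_eq_lattice_sum scale by simp
  finally show ?thesis
    by (simp only: c(3) h_def)
qed

end
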